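(* Let $X_1,\dots,X_n$ be i.i.d. with continuous distribution function $F$ on $[0,\infty)$ having finite mean and a density $f$ with $f(x)>0$ for all $x\ge 0$. Let $a_n=\alpha n^{-1}\log\log n$ with $\alpha>1$, and $b_n=F^{-1}(1-a_n)$. (i) Suppose there exists $h\in\mathcal H(\downarrow)$ such that $$M_1\equiv\sup_{x\ge 0}\frac{\int_x^\infty h(F(t))\,dt\,/\,h(F(x))}{e(x)}<\infty .$$ Then $$\sup\left\{\frac{|\hat e_n(x)-e(x)|\,\overline F(x)}{h(F(x))\,e(x)}:\ 0\le x\le b_n\right\}\to 0\quad\text{almost surely as } n\to\infty.$$ (ii) Suppose there exists $h\in\mathcal H(\downarrow)$ with $\int_0^\infty h(F(t))\,dt<\infty$ and $\sup_{x\ge0} e(x)h(F(x))<\infty$. Then $$\sup\{|\hat e_n(x)-e(x)|\,\overline F(x):\ 0\le x\le b_n\}\to 0\quad\text{almost surely as } n\to\infty.$$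
   Context: $\overline F=1-F$. The mean residual life function is $e(x)=E(X-x\mid X>x)=\int_x^\infty\overline F(t)\,dt/\overline F(x)$ for $x\ge0$. $\mathbb F_n$ is the empirical distribution function of $X_1,\dots,X_n$, $\overline{\mathbb F}_n=1-\mathbb F_n$, $X_{nn}=\max_i X_i$, and the estimator is $\hat e_n(x)=\left\{\int_x^\infty\overline{\mathbb F}_n(t)\,dt/\overline{\mathbb F}_n(x)\right\}1_{[0,X_{nn})}(x)$. $\mathcal H(\downarrow)$ denotes the set of all nonnegative, nonincreasing functions $h$ on $[0,1]$ with $\int_0^1 (1/h(t))\,dt<\infty$. *)

theory Defs
  imports "HOL-Probability.Probability"
begin

definition mrl :: "(real \<Rightarrow> real) \<Rightarrow> real \<Rightarrow> real" where
  "mrl F x = integral {x..} (\<lambda>t. 1 - F t) / (1 - F x)"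

definition ecdf :: "(nat \<Rightarrow> 'a \<Rightarrow> real) \<Rightarrow> nat \<Rightarrow> 'a \<Rightarrow> real \<Rightarrow> real" where
  "ecdf X n w x = real (card {i \<in> {..<n}. X i w \<le> x}) / real n"

definition smax :: "(nat \<Rightarrow> 'a \<Rightarrow> real) \<Rightarrow> nat \<Rightarrow> 'a \<Rightarrow> real" where
  "smax X n w = Max ((\<lambda>i. X i w) ` {..<n})"

definition emrl :: "(nat \<Rightarrow> 'a \<Rightarrow> real) \<Rightarrow> nat \<Rightarrow> 'a \<Rightarrow> real \<Rightarrow> real" where
  "emrl X n w x =
     (if 0 \<le> x \<and> x < smax X n w
      then integral {x..} (\<lambda>t. 1 - ecdf X n w t) / (1 - ecdf X n w x)
      else 0)"

definition qf :: "(real \<Rightarrow> real) \<Rightarrow> real \<Rightarrow> real" where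
  "qf F u = Inf {x. u \<le> F x}"

text \<open>The class H(decreasing): nonnegative, nonincreasing on [0,1], with int_0^1 1/h < infty
  (the integral taken in [0,infty], 1/0 = infty).\<close>
definition Hdec :: "(real \<Rightarrow> real) \<Rightarrow> bool" where
  "Hdec h \<longleftrightarrow> (\<forall>t\<in>{0..1}. 0 \<le> h t) \<and>
     (\<forall>s\<in>{0..1}. \<forall>t\<in>{0..1}. s \<le> t \<longrightarrow> h t \<le> h s) \<and>
     (\<integral>\<^sup>+ t. indicator {0..1} t * inverse (ennreal (h t)) \<partial>lborel) < \<infinity>"

end

theory Submission
  imports Defs "HOL-Real_Asymp.Real_Asymp"
begin

text \<open>
  The variables \<open>F (X i)\<close> are iid uniform on the unit interval. Writing \<open>S = 1 - F\<close> and \<open>S\<^sub>n\<close> for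
  its empirical version, one has
  \<open>(emrl - mrl) S = S / S\<^sub>n * (\<integral>\<^sub>x (S\<^sub>n - S) - (S\<^sub>n - S) mrl)\<close>. The bracket is small
  by a weighted Glivenko-Cantelli theorem, \<open>\<bar>S\<^sub>n - S\<bar> \<le> \<eta> h(F)\<close> eventually, for which integrability
  of \<open>1 / h\<close> is exactly what is needed; the factor \<open>S / S\<^sub>n\<close> stays bounded on \<open>{0..b n}\<close> by
  a Chernoff bound and the Borel-Cantelli lemma along geometric blocks. The same bound gives \<open>S\<^sub>n > 0\<close>
  there, so \<open>b n\<close> lies below the sample maximum.
\<close>

section \<open>A dyadic law of large numbers\<close>

text \<open>The weighted Glivenko-Cantelli bound cannot control \<open>S / S\<^sub>n\<close>. For
  nonincreasing \<open>h\<close> the quotient (1 - t) / h t is at most the integral of 1 / h over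
  [t, 1], which tends to 0 as t tends to 1; so near the right end the allowed deviation \<eta> *
  h(F) exceeds S itself and would permit \<open>S\<^sub>n = 0\<close>. The ratio therefore gets its
  own argument, and it alone dictates the cutoff \<open>b n\<close>: beyond \<open>b n\<close> about
  \<alpha> ln ln n observations are expected. A lower bound \<open>c * S\<close> with some small c >
  0 is enough, and this is what admits every \<alpha> > 1: as c shrinks, the Chernoff exponent
  approaches the full expected count, whereas c near 1 would require a large \<alpha>.

  Parts (i) and (ii) differ only in the bound for the tail integral of h(F) and in the normaliser,
  so both are instances of one statement with these two functions left free.\<close>

lemma (in prob_space) variance_sum_indep:
  fixes Z :: "'i \<Rightarrow> 'a \<Rightarrow> real"
  assumes fin: "finite I" and indep: "indep_vars (\<lambda>_. borel) Z I"
    and sq: "\<And>i. i \<in> I \<Longrightarrow> integrable M (\<lambda>w. (Z i w)\<^sup>2)"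
  shows "integrable M (\<lambda>w. (\<Sum>i\<in>I. Z i w)\<^sup>2)"
    and "variance (\<lambda>w. \<Sum>i\<in>I. Z i w) = (\<Sum>i\<in>I. variance (Z i))"
proof -
  have rv: "i \<in> I \<Longrightarrow> Z i \<in> borel_measurable M" for i
    using indep by (auto simp: indep_vars_def)
  have int: "i \<in> I \<Longrightarrow> integrable M (Z i)" for i
    using square_integrable_imp_integrable[OF rv sq] .
  \<comment> \<open>After centring, each cross term \<open>W i w * ?S w\<close> has expectation 0,
    so the induction can run on plain second moments.\<close>
  define W where "W i w = Z i w - expectation (Z i)" for i w
  have indepW: "indep_vars (\<lambda>_. borel) W I"
    unfolding W_def using indep by (rule indep_vars_compose2) auto
  have rvW: "i \<in> I \<Longrightarrow> W i \<in> borel_measurable M" for i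
    using indepW by (auto simp: indep_vars_def)
  have intW: "i \<in> I \<Longrightarrow> integrable M (W i)" for i
    unfolding W_def using int by auto
  have EW: "i \<in> I \<Longrightarrow> expectation (W i) = 0" for i
    unfolding W_def using int by (simp add: prob_space)
  have sqW: "i \<in> I \<Longrightarrow> integrable M (\<lambda>w. (W i w)\<^sup>2)" for i
    unfolding W_def power2_diff using int sq by auto
  have "integrable M (\<lambda>w. (\<Sum>i\<in>J. W i w)\<^sup>2) \<and>
      expectation (\<lambda>w. (\<Sum>i\<in>J. W i w)\<^sup>2) = (\<Sum>i\<in>J. expectation (\<lambda>w. (W i w)\<^sup>2))"
    if "J \<subseteq> I" for J
    using finite_subset[OF that fin] that
  proof (induction J rule: finite_induct)
    case empty
    then show ?case by simp
  next
    case (insert i J)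
    let ?S = "\<lambda>w. \<Sum>i\<in>J. W i w"
    have ind: "indep_var borel (W i) borel ?S"
      using insert by (intro indep_vars_sum indep_vars_subset[OF indepW]) auto
    have intS: "integrable M ?S"
      using insert intW by auto
    have "expectation (\<lambda>w. W i w * ?S w) = 0"
      using indep_var_lebesgue_integral[OF ind _ intS] intW EW insert by auto
    moreover have "integrable M (\<lambda>w. W i w * ?S w)"
      using indep_var_integrable[OF ind _ intS] intW insert by auto
    moreover have "(\<lambda>w. (\<Sum>i\<in>insert i J. W i w)\<^sup>2) = (\<lambda>w. (W i w)\<^sup>2 + (?S w)\<^sup>2 + 2 * (W i w * ?S w))"
      using insert by (simp add: power2_sum algebra_simps)
    ultimately show ?case
      using insert sqW[of i] by (simp del: distrib_left_numeral)
  qed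
  note * = this[OF order_refl]
  have "(\<Sum>i\<in>I. W i w) = (\<Sum>i\<in>I. Z i w) - (\<Sum>i\<in>I. expectation (Z i))" for w
    by (simp add: W_def sum_subtractf)
  moreover have "expectation (\<lambda>w. \<Sum>i\<in>I. Z i w) = (\<Sum>i\<in>I. expectation (Z i))"
    using int by (simp add: Bochner_Integration.integral_sum)
  ultimately show "variance (\<lambda>w. \<Sum>i\<in>I. Z i w) = (\<Sum>i\<in>I. variance (Z i))"
    using conjunct2[OF *] by (simp add: W_def)
  have "(\<lambda>w. (\<Sum>i\<in>I. Z i w)\<^sup>2) = (\<lambda>w. (\<Sum>i\<in>I. W i w)\<^sup>2 + 2 * (\<Sum>i\<in>I. expectation (Z i)) * (\<Sum>i\<in>I. W i w)
     + (\<Sum>i\<in>I. expectation (Z i))\<^sup>2)"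
    by (auto simp: W_def sum_subtractf power2_eq_square algebra_simps)
  then show "integrable M (\<lambda>w. (\<Sum>i\<in>I. Z i w)\<^sup>2)"
    using conjunct1[OF *] intW by auto
qed

text \<open>The powers below y form a geometric sum dominated by its largest term. Under the
  expectation this makes the sum over k of 2^k P(Y > 2^k) at most 2 E Y.\<close>

lemma sum_dyadic_below_le:
  fixes y :: real assumes "0 \<le> y"
  shows "(\<Sum>k<K. if 2 ^ k < y then 2 ^ k else 0) \<le> 2 * y"
proof (induction K)
  case (Suc K)
  show ?case
  proof (cases "2 ^ K < y")
    case True
    have "(\<Sum>k<Suc K. if 2 ^ k < y then 2 ^ k else 0) \<le> (\<Sum>k<Suc K. 2 ^ k :: real)"
      by (intro sum_mono) auto
    also have "\<dots> = 2 ^ Suc K - 1"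
      by (induction K) auto
    finally show ?thesis using True by simp
  qed (use Suc in simp)
qed (use assms in simp)

lemma sum_dyadic_above_le:
  fixes y :: real assumes "0 \<le> y"
  shows "(\<Sum>k<K. if y \<le> 2 ^ k then y\<^sup>2 / 2 ^ k else 0) \<le> 2 * y"
proof (cases K)
  case (Suc L)
  \<comment> \<open>Once y \<le> 2^k the terms halve, so the remaining tail equals the last term;
    subtracting it gives a bound that is preserved by induction.\<close>
  have "(\<Sum>k<Suc L. if y \<le> 2 ^ k then y\<^sup>2 / 2 ^ k else 0)
      \<le> 2 * y - (if y \<le> 2 ^ L then y\<^sup>2 / 2 ^ L else 0)"
  proof (induction L)
    case 0
    then show ?case using assms mult_left_mono[of y 1 y] by (auto simp: power2_eq_square)
  next
    case (Suc L)
    show ?case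
    proof (cases "y \<le> 2 ^ L")
      case True
      then have "y \<le> 2 ^ Suc L" using assms by simp
      then show ?thesis using Suc True by (simp add: field_simps)
    next
      case False
      have "(\<Sum>k<Suc L. if y \<le> 2 ^ k then y\<^sup>2 / 2 ^ k else 0) = 0"
      proof (intro sum.neutral ballI)
        fix k assume "k \<in> {..<Suc L}"
        then have "(2::real) ^ k \<le> 2 ^ L" by (intro power_increasing) auto
        then have "\<not> y \<le> 2 ^ k" using False by linarith
        then show "(if y \<le> 2 ^ k then y\<^sup>2 / 2 ^ k else 0) = 0" by auto
      qed
      moreover have "2 * (y\<^sup>2 / 2 ^ Suc L) \<le> 2 * y" if "y \<le> 2 ^ Suc L"
        using that mult_left_mono[OF that assms] assms by (simp add: field_simps power2_eq_square)
      ultimately show ?thesis using assms by (subst sum.lessThan_Suc) auto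
    qed
  qed
  moreover have "0 \<le> (if y \<le> 2 ^ L then y\<^sup>2 / 2 ^ L else 0)" by auto
  ultimately show ?thesis unfolding Suc by linarith
qed (use assms in simp)

text \<open>Truncating at \<open>2 ^ k\<close> the first \<open>2 ^ k\<close> variables makes both the truncation error and the
  Chebyshev bound summable in \<open>k\<close>; interpolating between dyadic times costs the factor 2, which is
  harmless for the weighted Glivenko-Cantelli theorem.\<close>

lemma (in prob_space) iid_sum_le:
  fixes Y :: "nat \<Rightarrow> 'a \<Rightarrow> real"
  assumes indep: "indep_vars (\<lambda>_. borel) Y UNIV"
    and id: "\<And>i. distr M borel (Y i) = distr M borel (Y 0)"
    and nonneg: "\<And>i w. 0 \<le> Y i w"
    and int: "integrable M (Y 0)" and eps: "0 < \<epsilon>"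
  shows "AE w in M. \<forall>\<^sub>F n in sequentially. (\<Sum>i<n. Y i w) \<le> 2 * real n * (expectation (Y 0) + \<epsilon>)"
proof -
  have rv[measurable]: "Y i \<in> borel_measurable M" for i
    using indep by (auto simp: indep_vars_def)
  define Z where "Z k y = (if y \<le> 2 ^ k then y else 0)" for k :: nat and y :: real
  have Zm[measurable]: "Z k \<in> borel_measurable borel" for k
    unfolding Z_def[abs_def] by measurable
  have Zle: "\<bar>Z k (Y i w)\<bar> \<le> 2 ^ k" "0 \<le> Z k (Y i w)" "Z k (Y i w) \<le> Y i w" for k i w
    using nonneg by (auto simp: Z_def)
  have Zint: "integrable M (\<lambda>w. Z k (Y i w))" for k i
    by (rule integrable_const_bound[where B="2 ^ k"]) (use Zle in auto)
  have Zsq: "integrable M (\<lambda>w. (Z k (Y i w))\<^sup>2)" for k i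
    by (rule integrable_const_bound[where B="(2 ^ k)\<^sup>2"])
       (use Zle in \<open>auto intro!: power_mono simp: abs_le_square_iff\<close>)
  have transfer: "expectation (\<lambda>w. g (Y i w)) = expectation (\<lambda>w. g (Y 0 w))"
    if [measurable]: "g \<in> borel_measurable borel" for g :: "real \<Rightarrow> real" and i
    using integral_distr[of "Y i" M borel g] integral_distr[of "Y 0" M borel g] id[of i] by simp
  define q where "q k = expectation (\<lambda>w. (Z k (Y 0 w))\<^sup>2)" for k
  define A where "A k = {w \<in> space M. \<exists>i<2 ^ k. 2 ^ k < Y i w}" for k :: nat
  \<comment> \<open>Chebyshev's inequality divides the sum of 2^k variances by (\<epsilon> 2^k)^2.
    What is left, \<open>q k / 2 ^ k\<close>, has the integrand of
    \<open>sum_dyadic_above_le\<close>.\<close>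
  define B where "B k = {w \<in> space M. \<epsilon> * 2 ^ k \<le>
      \<bar>(\<Sum>i<2^k. Z k (Y i w)) - expectation (\<lambda>w. \<Sum>i<2^k. Z k (Y i w))\<bar>}" for k :: nat
  have A_sets[measurable]: "A k \<in> sets M" for k unfolding A_def by measurable
  have B_sets[measurable]: "B k \<in> sets M" for k unfolding B_def by measurable
  have A_le: "prob (A k) \<le> expectation (\<lambda>w. if 2 ^ k < Y 0 w then 2 ^ k else 0)" for k
  proof -
    have "prob {w \<in> space M. 2 ^ k < Y i w} = expectation (\<lambda>w. indicator {2 ^ k<..} (Y i w))" for i
    proof -
      have "expectation (\<lambda>w. indicator {2 ^ k<..} (Y i w))
          = expectation (indicator {w \<in> space M. 2 ^ k < Y i w} :: _ \<Rightarrow> real)"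
        by (intro Bochner_Integration.integral_cong) (auto simp: indicator_def)
      then show ?thesis by simp
    qed
    then have eq: "prob {w \<in> space M. 2 ^ k < Y i w} = expectation (\<lambda>w. indicator {2 ^ k<..} (Y 0 w))" for i
      using transfer[of "indicator {2 ^ k<..}" i] by simp
    have "A k = (\<Union>i<2 ^ k. {w \<in> space M. 2 ^ k < Y i w})" by (auto simp: A_def)
    then have "prob (A k) \<le> (\<Sum>i<2^k. prob {w \<in> space M. 2 ^ k < Y i w})"
      by (simp only:) (rule measure_UNION_le, auto)
    also have "\<dots> = expectation (\<lambda>w. 2 ^ k * indicator {2 ^ k<..} (Y 0 w))" by (simp add: eq)
    finally show ?thesis by (simp add: indicator_def of_bool_def if_distrib cong: if_cong)
  qed
  have B_le: "prob (B k) \<le> expectation (\<lambda>w. if Y 0 w \<le> 2 ^ k then (Y 0 w)\<^sup>2 / 2 ^ k else 0) / \<epsilon>\<^sup>2" for k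
  proof -
    have ind: "indep_vars (\<lambda>_. borel) (\<lambda>i w. Z k (Y i w)) {..<2 ^ k}"
      by (rule indep_vars_compose2[OF indep_vars_subset[OF indep]]) auto
    note var = variance_sum_indep[OF _ ind Zsq]
    have "prob (B k) \<le> variance (\<lambda>w. \<Sum>i<2^k. Z k (Y i w)) / (\<epsilon> * 2 ^ k)\<^sup>2"
      unfolding B_def by (rule Chebyshev_inequality) (use eps var in auto)
    also have "variance (\<lambda>w. \<Sum>i<2^k. Z k (Y i w)) = (\<Sum>i<2^k. variance (\<lambda>w. Z k (Y i w)))"
      by (rule var) auto
    also have "\<dots> \<le> (\<Sum>i<(2::nat)^k. q k)"
    proof (rule sum_mono)
      fix i
      have "variance (\<lambda>w. Z k (Y i w)) \<le> expectation (\<lambda>w. (Z k (Y i w))\<^sup>2)"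
        using Zint Zsq by (subst variance_eq) auto
      also have "\<dots> = q k" unfolding q_def using transfer[of "\<lambda>y. (Z k y)\<^sup>2" i] by simp
      finally show "variance (\<lambda>w. Z k (Y i w)) \<le> q k" .
    qed
    also have "(\<Sum>i<(2::nat)^k. q k) / (\<epsilon> * 2 ^ k)\<^sup>2 = q k / 2 ^ k / \<epsilon>\<^sup>2"
      by (simp add: power2_eq_square field_simps)
    also have "q k / 2 ^ k = expectation (\<lambda>w. (Z k (Y 0 w))\<^sup>2 / 2 ^ k)" by (simp add: q_def)
    also have "(\<lambda>w. (Z k (Y 0 w))\<^sup>2 / 2 ^ k) = (\<lambda>w. if Y 0 w \<le> 2 ^ k then (Y 0 w)\<^sup>2 / 2 ^ k else 0)"
      by (auto simp: Z_def)
    finally show ?thesis by (simp add: divide_right_mono)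
  qed
  have sumA: "summable (\<lambda>k. expectation (\<lambda>w. if 2 ^ k < Y 0 w then 2 ^ k else (0::real)))"
  proof (rule summableI_nonneg_bounded)
    fix K
    have i: "integrable M (\<lambda>w. if 2 ^ k < Y 0 w then 2 ^ k else (0::real))" for k :: nat
      by (rule integrable_const_bound[where B="2 ^ k"]) auto
    then have "(\<Sum>k<K. expectation (\<lambda>w. if 2 ^ k < Y 0 w then 2 ^ k else (0::real)))
       = expectation (\<lambda>w. \<Sum>k<K. if 2 ^ k < Y 0 w then 2 ^ k else (0::real))"
      by (simp add: Bochner_Integration.integral_sum)
    also have "\<dots> \<le> expectation (\<lambda>w. 2 * Y 0 w)"
      using i int nonneg by (intro integral_mono sum_dyadic_below_le) auto
    finally show "(\<Sum>k<K. expectation (\<lambda>w. if 2 ^ k < Y 0 w then 2 ^ k else (0::real)))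
      \<le> expectation (\<lambda>w. 2 * Y 0 w)" .
  qed auto
  have sumB: "summable (\<lambda>k. expectation (\<lambda>w. if Y 0 w \<le> 2 ^ k then (Y 0 w)\<^sup>2 / 2 ^ k else 0))"
  proof (rule summableI_nonneg_bounded)
    fix K
    have i: "integrable M (\<lambda>w. if Y 0 w \<le> 2 ^ k then (Y 0 w)\<^sup>2 / 2 ^ k else (0::real))" for k :: nat
      by (rule integrable_const_bound[where B="(2 ^ k)\<^sup>2 / 2 ^ k"])
         (use nonneg in \<open>auto intro!: divide_right_mono power_mono\<close>)
    then have "(\<Sum>k<K. expectation (\<lambda>w. if Y 0 w \<le> 2 ^ k then (Y 0 w)\<^sup>2 / 2 ^ k else (0::real)))
       = expectation (\<lambda>w. \<Sum>k<K. if Y 0 w \<le> 2 ^ k then (Y 0 w)\<^sup>2 / 2 ^ k else (0::real))"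
      by (simp add: Bochner_Integration.integral_sum)
    also have "\<dots> \<le> expectation (\<lambda>w. 2 * Y 0 w)"
      using i int nonneg by (intro integral_mono sum_dyadic_above_le) auto
    finally show "(\<Sum>k<K. expectation (\<lambda>w. if Y 0 w \<le> 2 ^ k then (Y 0 w)\<^sup>2 / 2 ^ k else (0::real)))
      \<le> expectation (\<lambda>w. 2 * Y 0 w)" .
  qed auto
  have "summable (\<lambda>k. prob (A k \<union> B k))"
  proof (rule summable_comparison_test[OF exI, rule_format])
    show "summable (\<lambda>k. expectation (\<lambda>w. if 2 ^ k < Y 0 w then 2 ^ k else 0) +
       expectation (\<lambda>w. if Y 0 w \<le> 2 ^ k then (Y 0 w)\<^sup>2 / 2 ^ k else 0) / \<epsilon>\<^sup>2)"
      by (intro summable_add sumA summable_divide sumB)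
    show "norm (prob (A k \<union> B k)) \<le> expectation (\<lambda>w. if 2 ^ k < Y 0 w then 2 ^ k else 0) +
       expectation (\<lambda>w. if Y 0 w \<le> 2 ^ k then (Y 0 w)\<^sup>2 / 2 ^ k else 0) / \<epsilon>\<^sup>2" for k
      using A_le[of k] B_le[of k] measure_Un_le[OF A_sets B_sets, of k k] by simp
  qed
  then have "AE w in M. \<forall>\<^sub>F k in sequentially. w \<in> space M - (A k \<union> B k)"
    by (intro borel_cantelli_AE1) (auto simp: emeasure_eq_measure)
  then show ?thesis
  proof eventually_elim
    case (elim w)
    let ?C = "expectation (Y 0) + \<epsilon>"
    have C0: "0 \<le> ?C" using eps nonneg by (intro add_nonneg_nonneg integral_nonneg) auto
    obtain K where K: "\<And>k. k \<ge> K \<Longrightarrow> w \<in> space M - (A k \<union> B k)"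
      using elim by (auto simp: eventually_sequentially)
    have dy: "(\<Sum>i<2^k. Y i w) \<le> 2 ^ k * ?C" if "k \<ge> K" for k
    proof -
      have "(\<Sum>i<2^k. Y i w) = (\<Sum>i<2^k. Z k (Y i w))"
        using K[OF that] by (intro sum.cong) (auto simp: A_def Z_def)
      also have "\<dots> \<le> expectation (\<lambda>w. \<Sum>i<2^k. Z k (Y i w)) + \<epsilon> * 2 ^ k"
        using K[OF that] by (auto simp: B_def)
      also have "expectation (\<lambda>w. \<Sum>i<2^k. Z k (Y i w)) = (\<Sum>i<(2::nat)^k. expectation (\<lambda>w. Z k (Y i w)))"
        using Zint by (simp add: Bochner_Integration.integral_sum)
      also have "\<dots> = (\<Sum>i<(2::nat)^k. expectation (\<lambda>w. Z k (Y 0 w)))"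
        by (intro sum.cong refl transfer) measurable
      also have "\<dots> \<le> (\<Sum>i<(2::nat)^k. expectation (Y 0))"
        using Zint int Zle by (intro sum_mono integral_mono) auto
      finally show ?thesis by (simp add: algebra_simps)
    qed
    show "\<forall>\<^sub>F n in sequentially. (\<Sum>i<n. Y i w) \<le> 2 * real n * ?C"
      using eventually_ge_at_top[of "2 ^ K"]
    proof eventually_elim
      case n: (elim n)
      have "n > 0" using n by (metis gr0I le_zero_eq power_eq_0_iff zero_neq_numeral)
      then obtain k where k: "2 ^ k \<le> n" "n < 2 ^ Suc k"
        using ex_power_ivl1[of 2 n] by auto
      have "(2::nat) ^ K < 2 ^ Suc k" using n k by linarith
      then have "K \<le> k" by (metis less_Suc_eq_le nat_power_less_imp_less zero_less_numeral)
      have "(\<Sum>i<n. Y i w) \<le> (\<Sum>i<2^Suc k. Y i w)"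
        using k nonneg by (intro sum_mono2) auto
      also have "\<dots> \<le> 2 ^ Suc k * ?C" using \<open>K \<le> k\<close> by (intro dy) auto
      also have "\<dots> = 2 * real (2 ^ k) * ?C" by simp
      also have "\<dots> \<le> 2 * real n * ?C"
        using k C0 by (intro mult_right_mono mult_left_mono) (auto simp del: of_nat_power)
      finally show ?case .
    qed
  qed
qed

section \<open>The upper tail of the uniform empirical distribution\<close>

locale iid_uniform = prob_space M for M :: "'a measure" +
  fixes U :: "nat \<Rightarrow> 'a \<Rightarrow> real"
  assumes indep: "indep_vars (\<lambda>_. borel) U UNIV"
    and uniform: "\<And>i t. t \<in> {0..1} \<Longrightarrow> prob {w \<in> space M. U i w \<le> t} = t"
begin

lemma U_measurable[measurable]: "U i \<in> borel_measurable M"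
  using indep by (auto simp: indep_vars_def)

text \<open>Parametrised by the tail mass v, so that n * v is the mean for v in [0, 1]. Being an
  unnormalised count, it is monotone in both n and v, unlike the empirical distribution function in
  n; this carries a bound from a block's first index to the whole block.\<close>

definition exceed :: "nat \<Rightarrow> real \<Rightarrow> 'a \<Rightarrow> real" where
  "exceed n v w = (\<Sum>i<n. indicator {1 - v<..} (U i w))"

lemma exceed_eq_ecdf: "0 < n \<Longrightarrow> exceed n v w = real n * (1 - ecdf U n w (1 - v))"
proof -
  assume n: "0 < n"
  have "exceed n v w = (\<Sum>i<n. 1 - indicator {i. U i w \<le> 1 - v} i)"
    unfolding exceed_def by (intro sum.cong) (auto simp: indicator_def)
  also have "\<dots> = real n - real (card ({..<n} \<inter> {i. U i w \<le> 1 - v}))"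
    by (simp add: sum_subtractf indicator_def sum_of_bool_eq)
  also have "{..<n} \<inter> {i. U i w \<le> 1 - v} = {i \<in> {..<n}. U i w \<le> 1 - v}" by auto
  finally show ?thesis using n by (simp add: ecdf_def right_diff_distrib)
qed

lemma exceed_mono: "m \<le> n \<Longrightarrow> v \<le> v' \<Longrightarrow> exceed m v w \<le> exceed n v' w"
proof -
  assume "m \<le> n" "v \<le> v'"
  have "exceed m v w \<le> (\<Sum>i<m. indicator {1 - v'<..} (U i w))"
    unfolding exceed_def using \<open>v \<le> v'\<close> by (intro sum_mono) (auto simp: indicator_def)
  also have "\<dots> \<le> exceed n v' w"
    unfolding exceed_def using \<open>m \<le> n\<close> by (intro sum_mono2) auto
  finally show ?thesis .
qed

lemma exceed_measurable[measurable]: "exceed n v \<in> borel_measurable M"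
  unfolding exceed_def[abs_def] by measurable

lemma prob_U_greater: "v \<in> {0..1} \<Longrightarrow> prob {w \<in> space M. 1 - v < U i w} = v"
proof -
  assume v: "v \<in> {0..1}"
  have "{w \<in> space M. 1 - v < U i w} = space M - {w \<in> space M. U i w \<le> 1 - v}" by auto
  then show ?thesis using uniform[of "1 - v" i] v by (simp add: prob_compl)
qed

text \<open>Chernoff's method: one factor has mean 1 - v (1 - exp (- s)), at most exp (- v (1 - exp
  (- s))), and independence multiplies these. The parameters s and c stay free because the exponent
  must later be tuned to \<alpha>.\<close>

lemma exceed_lower_tail:
  assumes v: "v \<in> {0..1}" and s: "0 < s"
  shows "prob {w \<in> space M. exceed n v w \<le> c * (real n * v)} \<le> exp (- (real n * v * (1 - exp (- s) - s * c)))"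
proof -
  have one: "(\<integral>\<^sup>+w. ennreal (exp (- s * indicator {1 - v<..} (U i w))) \<partial>M) \<le> ennreal (exp (- (v * (1 - exp (- s)))))" for i
  proof -
    let ?I = "indicator {w \<in> space M. 1 - v < U i w} :: 'a \<Rightarrow> real"
    have "(\<integral>\<^sup>+w. ennreal (exp (- s * indicator {1 - v<..} (U i w))) \<partial>M)
        = (\<integral>\<^sup>+w. ennreal (1 - (1 - exp (- s)) * ?I w) \<partial>M)"
      by (intro nn_integral_cong) (auto simp: indicator_def)
    also have "\<dots> = ennreal (expectation (\<lambda>w. 1 - (1 - exp (- s)) * ?I w))"
      using s by (intro nn_integral_eq_integral) (auto simp: indicator_def intro!: integrable_const_bound[where B=1])
    also have "expectation (\<lambda>w. 1 - (1 - exp (- s)) * ?I w) = 1 - (1 - exp (- s)) * v"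
    proof -
      have "integrable M ?I" by (intro integrable_real_indicator) (auto simp: emeasure_eq_measure)
      then show ?thesis using prob_U_greater[OF v, of i] by (simp add: prob_space)
    qed
    also have "\<dots> \<le> exp (- (v * (1 - exp (- s))))"
      using exp_ge_add_one_self[of "- (v * (1 - exp (- s)))"] by (simp add: mult.commute)
    finally show ?thesis by (simp add: ennreal_leI)
  qed
  have "ennreal (prob {w \<in> space M. exceed n v w \<le> c * (real n * v)})
      = emeasure M {w \<in> space M. exceed n v w \<le> c * (real n * v)}"
    by (simp add: emeasure_eq_measure)
  also have "\<dots> \<le> ennreal (exp (s * (c * (real n * v)))) * (\<integral>\<^sup>+w\<in>space M. ennreal (exp (- s * exceed n v w)) \<partial>M)"
    by (rule Chernoff_ineq_nn_integral_le) (use s in auto)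
  also have "(\<integral>\<^sup>+w\<in>space M. ennreal (exp (- s * exceed n v w)) \<partial>M)
      = (\<integral>\<^sup>+w. (\<Prod>i<n. ennreal (exp (- s * indicator {1 - v<..} (U i w)))) \<partial>M)"
    by (intro nn_integral_cong)
       (simp add: exceed_def sum_distrib_left exp_sum prod_ennreal flip: sum_negf)
  also have "\<dots> = (\<Prod>i<n. \<integral>\<^sup>+w. ennreal (exp (- s * indicator {1 - v<..} (U i w))) \<partial>M)"
    by (rule indep_vars_nn_integral, simp, rule indep_vars_compose2[OF indep_vars_subset[OF indep]]) auto
  also have "ennreal (exp (s * (c * (real n * v)))) * \<dots>
      \<le> ennreal (exp (s * (c * (real n * v)))) * (\<Prod>i<n. ennreal (exp (- (v * (1 - exp (- s))))))"
    by (intro mult_left_mono prod_mono_ennreal one) auto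
  also have "\<dots> = ennreal (exp (s * (c * (real n * v))) * exp (- (v * (1 - exp (- s)))) ^ n)"
    by (simp add: ennreal_power ennreal_mult)
  also have "exp (s * (c * (real n * v))) * exp (- (v * (1 - exp (- s)))) ^ n
      = exp (- (real n * v * (1 - exp (- s) - s * c)))"
    by (simp add: exp_of_nat_mult[symmetric] mult_exp_exp algebra_simps)
  finally show ?thesis by simp
qed

end

section \<open>Geometric blocks and the iterated logarithm\<close>

lemma ex_power_ivl_real:
  fixes x \<rho> :: real assumes "1 \<le> x" "1 < \<rho>"
  shows "\<exists>k. \<rho> ^ k \<le> x \<and> x < \<rho> ^ Suc k"
proof -
  obtain m where m: "x < \<rho> ^ m" using real_arch_pow[OF assms(2)] by auto
  define k where "k = (LEAST k. x < \<rho> ^ k)"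
  have k: "x < \<rho> ^ k" unfolding k_def using m by (rule LeastI)
  with assms have "k \<noteq> 0" by (intro notI) simp
  then have "\<not> x < \<rho> ^ (k - 1)" unfolding k_def by (intro not_less_Least) auto
  then show ?thesis using k \<open>k \<noteq> 0\<close> by (intro exI[of _ "k - 1"]) auto
qed

text \<open>The numerator 1 / ln z - ln (ln z) of the derivative is nonpositive once ln (ln z) \<ge>
  1, whence the threshold exp (exp 1). The level at a block's end is then the smallest in the block,
  so a grid starting there reaches every admissible v.\<close>

lemma lnln_div_antimono:
  fixes x y :: real
  assumes "exp (exp 1) \<le> x" "x \<le> y"
  shows "ln (ln y) / y \<le> ln (ln x) / x"
proof (rule DERIV_nonpos_imp_nonincreasing[OF assms(2)])
  fix z assume z: "x \<le> z" "z \<le> y"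
  have z0: "exp (exp 1) \<le> z" using assms z by simp
  then have pos: "0 < z" by (rule less_le_trans[rotated]) simp
  have lnz: "exp 1 \<le> ln z" using z0 pos by (simp add: ln_ge_iff)
  then have lnz0: "0 < ln z" by (rule less_le_trans[rotated]) simp
  have lnlnz: "1 \<le> ln (ln z)" using lnz lnz0 by (simp add: ln_ge_iff)
  have "1 \<le> ln z" using lnz exp_ge_add_one_self[of 1] by simp
  have "1 / ln z \<le> 1" using \<open>1 \<le> ln z\<close> by simp
  then have "1 / ln z - ln (ln z) \<le> 0" using lnlnz by simp
  moreover have "((\<lambda>z. ln (ln z) / z) has_real_derivative (1 / ln z - ln (ln z)) / z\<^sup>2) (at z)"
    using pos lnz0 by (auto intro!: derivative_eq_intros simp: field_simps power2_eq_square)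
  ultimately show "\<exists>D. ((\<lambda>z. ln (ln z) / z) has_real_derivative D) (at z) \<and> D \<le> 0"
    by (intro exI[of _ "(1 / ln z - ln (ln z)) / z\<^sup>2"]) (auto intro: divide_nonpos_nonneg)
qed

context iid_uniform begin

text \<open>For \<open>n\<close> in a block \<open>[\<rho> ^ k, \<rho> ^ Suc k)\<close> it is enough to control the block's first index at
  the grid points \<open>A (\<rho> ^ Suc k) * 2 ^ j\<close>. With \<open>l k = ln (\<rho> ^ Suc k)\<close>, the failure
  probability at the \<open>j\<close>-th grid point is at most \<open>(l k powr - \<delta>) ^ Suc j\<close>, where \<open>\<delta> > 1\<close> is
  possible because \<open>\<alpha> > 1\<close>.\<close>

lemma exceed_ge:
  assumes alpha: "1 < \<alpha>"
  shows "\<exists>c>0. AE w in M. \<forall>\<^sub>F n in sequentially.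
    \<forall>v\<in>{\<alpha> * ln (ln (real n)) / real n..1}. c * (real n * v) \<le> exceed n v w"
proof -
  \<comment> \<open>A block costs a factor \<rho> in the expected count, so \<rho> must stay below
    \<alpha>.\<close>
  define \<rho> where "\<rho> = (1 + \<alpha>) / 2"
  have rho: "1 < \<rho>" "\<rho> < \<alpha>" using alpha by (auto simp: \<rho>_def)
  define s where "s = max 1 (- ln ((1 - \<rho> / \<alpha>) / 4))"
  have s: "0 < s" by (auto simp: s_def)
  have "\<rho> / \<alpha> < 1" using rho by simp
  have "exp (- s) \<le> exp (ln ((1 - \<rho> / \<alpha>) / 4))" by (simp add: s_def)
  also have "\<dots> = (1 - \<rho> / \<alpha>) / 4" using \<open>\<rho> / \<alpha> < 1\<close> by simp
  finally have es: "exp (- s) \<le> (1 - \<rho> / \<alpha>) / 4" .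
  \<comment> \<open>This gives \<open>s * c = exp (- s)\<close>, hence
    \<open>\<gamma> = 1 - 2 * exp (- s)\<close>, and the choice of s keeps \<gamma> above \<rho> /
    \<alpha>.\<close>
  define c where "c = exp (- s) / s"
  define \<gamma> where "\<gamma> = 1 - exp (- s) - s * c"
  define \<delta> where "\<delta> = \<gamma> * \<alpha> / \<rho>"
  have "\<rho> / \<alpha> < \<gamma>" unfolding \<gamma>_def c_def using s es \<open>\<rho> / \<alpha> < 1\<close> by simp
  moreover have "0 < \<rho> / \<alpha>" using rho by simp
  ultimately have gamma: "0 < \<gamma>" by linarith
  have delta: "1 < \<delta>"
    using \<open>\<rho> / \<alpha> < \<gamma>\<close> rho by (simp add: \<delta>_def field_simps)
  have c: "0 < c" using s by (simp add: c_def)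
  define A where "A x = \<alpha> * ln (ln x) / x" for x :: real
  define m where "m k = nat \<lceil>\<rho> ^ k\<rceil>" for k :: nat
  define l where "l k = real (Suc k) * ln \<rho>" for k
  define E where "E k j = {w \<in> space M. exceed (m k) (A (\<rho> ^ Suc k) * 2 ^ j) w
      \<le> c * (real (m k) * (A (\<rho> ^ Suc k) * 2 ^ j))}" for k j
  define J where "J k = {j. A (\<rho> ^ Suc k) * 2 ^ j \<le> 1}" for k
  have lnrho: "0 < ln \<rho>" using rho by simp
  have Ak: "A (\<rho> ^ Suc k) = \<alpha> * ln (l k) / \<rho> ^ Suc k" for k
    using rho by (simp only: A_def l_def ln_realpow)
  have lbig: "\<forall>\<^sub>F k in sequentially. l k > C" for C
  proof -
    have "filterlim l at_top sequentially"
      unfolding l_def[abs_def] using lnrho by real_asymp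
    then show ?thesis by (simp add: filterlim_at_top_dense)
  qed
  have finJ: "finite (J k)" if "1 < l k" for k
  proof -
    have Apos: "0 < A (\<rho> ^ Suc k)" unfolding Ak using that alpha rho by auto
    obtain L where L: "1 / A (\<rho> ^ Suc k) < 2 ^ L" using real_arch_pow[of 2] by auto
    have "J k \<subseteq> {..<L}"
    proof
      fix j assume "j \<in> J k"
      then have "2 ^ j \<le> 1 / A (\<rho> ^ Suc k)" using Apos by (simp add: J_def field_simps)
      with L have "(2::real) ^ j < 2 ^ L" by linarith
      then show "j \<in> {..<L}" by simp
    qed
    then show ?thesis by (rule finite_subset) simp
  qed
  have [measurable]: "E k j \<in> sets M" for k j unfolding E_def by measurable
  have Ebound: "prob (E k j) \<le> (l k powr - \<delta>) ^ Suc j" if "j \<in> J k" "1 < l k" for k j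
  proof -
    have lk: "0 < ln (l k)" using that by simp
    let ?v = "A (\<rho> ^ Suc k) * 2 ^ j"
    have v: "?v \<in> {0..1}" using that lk alpha rho by (auto simp: J_def Ak simp del: power_Suc)
    \<comment> \<open>Weakening the exponent 2^j to j + 1 turns the bounds over the grid into a
      geometric series.\<close>
    have "real (Suc j) \<le> 2 ^ j" using less_exp[of j] by (metis Suc_leI of_nat_le_iff of_nat_numeral of_nat_power)
    have "prob (E k j) \<le> exp (- (real (m k) * ?v * \<gamma>))"
      unfolding E_def \<gamma>_def by (rule exceed_lower_tail[OF v s])
    also have "\<dots> \<le> exp (- (\<rho> ^ k * ?v * \<gamma>))"
    proof -
      have "\<rho> ^ k \<le> real (m k)" unfolding m_def by (rule real_nat_ceiling_ge)
      then have "\<rho> ^ k * ?v * \<gamma> \<le> real (m k) * ?v * \<gamma>" using v gamma by (intro mult_right_mono) auto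
      then show ?thesis by simp
    qed
    also have "\<rho> ^ k * ?v * \<gamma> = \<delta> * ln (l k) * 2 ^ j"
      unfolding Ak \<delta>_def using rho by simp
    also have "exp (- (\<delta> * ln (l k) * 2 ^ j)) \<le> exp (- (\<delta> * ln (l k) * real (Suc j)))"
      using \<open>real (Suc j) \<le> 2 ^ j\<close> lk delta by (simp del: of_nat_Suc)
    also have "\<dots> = (l k powr - \<delta>) ^ Suc j"
      using that by (simp add: powr_def exp_of_nat_mult[symmetric] mult_ac del: of_nat_Suc power_Suc)
    finally show ?thesis .
  qed
  have half: "\<forall>\<^sub>F k in sequentially. l k powr - \<delta> \<le> 1 / 2"
  proof -
    have "(\<lambda>k. l k powr - \<delta>) \<longlonglongrightarrow> 0"
      unfolding l_def[abs_def] using lnrho delta by real_asymp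
    then have "\<forall>\<^sub>F k in sequentially. l k powr - \<delta> < 1 / 2"
      by (rule order_tendstoD) simp
    then show ?thesis by eventually_elim simp
  qed
  \<comment> \<open>If \<open>l k \<le> 1\<close>, the level \<open>A (\<rho> ^ Suc k)\<close> is
    not positive and \<open>J k\<close> is infinite; such k are discarded, as \<open>l k\<close>
    tends to infinity.\<close>
  define D where "D k = (if 1 < l k then (\<Union>j\<in>J k. E k j) else {})" for k
  have D_sets[measurable]: "D k \<in> sets M" for k
    unfolding D_def using finJ by auto
  have "summable (\<lambda>k. prob (D k))"
  proof (rule summable_comparison_test_ev)
    show "\<forall>\<^sub>F k in sequentially. norm (prob (D k)) \<le> 2 * (ln \<rho> powr - \<delta> * real (Suc k) powr - \<delta>)"
      using half lbig[of 1]
    proof eventually_elim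
      case (elim k)
      let ?p = "l k powr - \<delta>"
      have p: "0 \<le> ?p" "?p \<le> 1/2" using elim by auto
      have "prob (D k) = prob (\<Union>j\<in>J k. E k j)" using elim by (simp add: D_def)
      also have "\<dots> \<le> (\<Sum>j\<in>J k. prob (E k j))"
        using finJ elim by (intro measure_UNION_le) auto
      also have "\<dots> \<le> (\<Sum>j\<in>J k. ?p ^ Suc j)"
        using elim by (intro sum_mono Ebound) auto
      also have "\<dots> \<le> (\<Sum>j. ?p ^ Suc j)"
        using p finJ elim by (intro sum_le_suminf) (auto intro!: summable_mult summable_geometric)
      also have "\<dots> = ?p * (1 / (1 - ?p))"
        using p by (simp add: suminf_mult suminf_geometric summable_geometric)
      also have "\<dots> \<le> ?p * 2"
        using p by (intro mult_left_mono) (auto simp: field_simps)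
      also have "?p = ln \<rho> powr - \<delta> * real (Suc k) powr - \<delta>"
        unfolding l_def using lnrho by (subst powr_mult) auto
      finally show ?case by simp
    qed
    have "summable (\<lambda>k. real (Suc k) powr - \<delta>)"
      using summable_Suc_iff[of "\<lambda>k. real k powr - \<delta>"] delta by (simp add: summable_real_powr_iff)
    then show "summable (\<lambda>k. 2 * (ln \<rho> powr - \<delta> * real (Suc k) powr - \<delta>))"
      by (intro summable_mult)
  qed
  then have "AE w in M. \<forall>\<^sub>F k in sequentially. w \<in> space M - D k"
    by (intro borel_cantelli_AE1) (auto simp: emeasure_eq_measure)
  \<comment> \<open>The constant loses a factor \<rho> because n may approach the end of its block,
    and a factor 2 because v lies between consecutive grid points.\<close>
  then have "AE w in M. \<forall>\<^sub>F n in sequentially.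
    \<forall>v\<in>{A (real n)..1}. c / (2 * \<rho>) * (real n * v) \<le> exceed n v w"
  proof eventually_elim
    case (elim w)
    have "\<forall>\<^sub>F k in sequentially. w \<in> space M - D k \<and> 1 < l k"
      using elim lbig[of 1] by eventually_elim auto
    then obtain K where K: "\<And>k. k \<ge> K \<Longrightarrow> w \<in> space M - D k \<and> 1 < l k"
      by (auto simp: eventually_sequentially)
    obtain N0 :: nat where N0: "max (exp (exp 1)) (\<rho> ^ K) \<le> real N0" using real_arch_simple by blast
    show ?case using eventually_ge_at_top[of N0]
    proof eventually_elim
      case (elim n)
      have n: "exp (exp 1) \<le> real n" "\<rho> ^ K \<le> real n" using N0 elim by linarith+
      have "1 \<le> real n" using n(1) exp_ge_add_one_self[of "exp 1"] exp_ge_zero[of "1::real"] by linarith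
      then obtain k where k: "\<rho> ^ k \<le> real n" "real n < \<rho> ^ Suc k"
        using ex_power_ivl_real[of "real n" \<rho>] rho by auto
      have "\<rho> ^ K < \<rho> ^ Suc k" using k n by linarith
      then have "K \<le> k" using rho by (simp add: power_strict_increasing_iff del: power_Suc)
      then have kK: "w \<in> space M - D k" "1 < l k" using K by auto
      have "ln (ln (\<rho> ^ Suc k)) / \<rho> ^ Suc k \<le> ln (ln (real n)) / real n"
        using n k by (intro lnln_div_antimono) auto
      then have AA: "A (\<rho> ^ Suc k) \<le> A (real n)"
        using alpha unfolding A_def by (simp only: times_divide_eq_right[symmetric]) (rule mult_left_mono, auto)
      have Apos: "0 < A (\<rho> ^ Suc k)" unfolding Ak using kK alpha rho by auto
      show ?case
      proof
        fix v assume v: "v \<in> {A (real n)..1}"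
        have "1 \<le> v / A (\<rho> ^ Suc k)" using AA Apos v by (auto simp: field_simps)
        then obtain j where j: "2 ^ j \<le> v / A (\<rho> ^ Suc k)" "v / A (\<rho> ^ Suc k) < 2 ^ Suc j"
          using ex_power_ivl_real[of "v / A (\<rho> ^ Suc k)" 2] by auto
        let ?v = "A (\<rho> ^ Suc k) * 2 ^ j"
        have vj: "?v \<le> v" "v < 2 * ?v" using j Apos by (auto simp: field_simps)
        then have "j \<in> J k" using v by (auto simp: J_def)
        then have "w \<notin> E k j" using kK by (auto simp: D_def)
        then have *: "c * (real (m k) * ?v) < exceed (m k) ?v w" using kK by (auto simp: E_def)
        have rk: "\<rho> ^ k \<le> real (m k)" unfolding m_def by (rule real_nat_ceiling_ge)
        have "m k \<le> n" unfolding m_def using k(1) by (simp add: nat_le_iff ceiling_le_iff)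
        have "real n * v \<le> (\<rho> * \<rho> ^ k) * (2 * ?v)"
          using k vj v Apos AA by (intro mult_mono) auto
        also have "\<dots> = 2 * \<rho> * (\<rho> ^ k * ?v)" by simp
        also have "\<dots> \<le> 2 * \<rho> * (real (m k) * ?v)"
          using rk rho Apos by (intro mult_left_mono mult_right_mono) auto
        finally have "c / (2 * \<rho>) * (real n * v) \<le> c / (2 * \<rho>) * (2 * \<rho> * (real (m k) * ?v))"
          using c rho by (intro mult_left_mono) auto
        also have "\<dots> = c * (real (m k) * ?v)" using rho by simp
        also have "\<dots> \<le> exceed (m k) ?v w" using * by simp
        also have "\<dots> \<le> exceed n v w" using \<open>m k \<le> n\<close> vj by (intro exceed_mono)
        finally show "c / (2 * \<rho>) * (real n * v) \<le> exceed n v w" .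
      qed
    qed
  qed
  then show ?thesis using c rho unfolding A_def by (intro exI[of _ "c / (2 * \<rho>)"]) auto
qed

end

section \<open>Weighted Glivenko-Cantelli theorem\<close>

lemma ecdf_mono: "s \<le> t \<Longrightarrow> ecdf X n w s \<le> ecdf X n w t"
  unfolding ecdf_def by (intro divide_right_mono of_nat_mono card_mono) auto

text \<open>Hoeffding's bound decays geometrically in n, so Borel-Cantelli applies along all n
  directly.\<close>

lemma (in iid_uniform) ecdf_tendsto_pointwise:
  assumes t: "t \<in> {0..1}" and eps: "0 < \<epsilon>"
  shows "AE w in M. \<forall>\<^sub>F n in sequentially. \<bar>ecdf U n w t - t\<bar> < \<epsilon>"
proof -
  define A where "A n = {w \<in> space M. real n * \<epsilon> \<le> \<bar>(\<Sum>i<n. indicator {..t} (U i w)) - real n * t\<bar>}" for n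
  have [measurable]: "A n \<in> sets M" for n unfolding A_def by measurable
  have bound: "prob (A n) \<le> 2 * exp (- 2 * \<epsilon>\<^sup>2) ^ n" if "0 < n" for n
  proof -
    interpret H: Hoeffding_ineq M "{..<n}" "\<lambda>i w. indicator {..t} (U i w)" "\<lambda>_. 0" "\<lambda>_. 1" "real n * t"
    proof unfold_locales
      show "indep_vars (\<lambda>_. borel) (\<lambda>i w. indicator {..t} (U i w)) {..<n}"
        by (rule indep_vars_compose2[OF indep_vars_subset[OF indep]]) auto
      have "expectation (\<lambda>w. indicator {..t} (U i w)) = t" for i
      proof -
        have "expectation (\<lambda>w. indicator {..t} (U i w)) = expectation (indicator {w \<in> space M. U i w \<le> t} :: _ \<Rightarrow> real)"
          by (intro Bochner_Integration.integral_cong) (auto simp: indicator_def)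
        then show ?thesis using uniform[OF t] by simp
      qed
      then show "real n * t \<equiv> (\<Sum>i<n. expectation (\<lambda>w. indicator {..t} (U i w)))" by simp
    qed (auto simp: indicator_def)
    have "prob (A n) \<le> 2 * exp (- 2 * (real n * \<epsilon>)\<^sup>2 / real n)"
      unfolding A_def using H.Hoeffding_ineq_abs_ge[of "real n * \<epsilon>"] that eps by simp
    also have "exp (- 2 * (real n * \<epsilon>)\<^sup>2 / real n) = exp (- 2 * \<epsilon>\<^sup>2) ^ n"
      using that by (simp add: exp_of_nat_mult[symmetric] power2_eq_square)
    finally show ?thesis .
  qed
  have "summable (\<lambda>n. prob (A n))"
  proof (rule summable_comparison_test_ev)
    show "\<forall>\<^sub>F n in sequentially. norm (prob (A n)) \<le> 2 * exp (- 2 * \<epsilon>\<^sup>2) ^ n"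
      using eventually_gt_at_top[of 0] by eventually_elim (use bound in auto)
    show "summable (\<lambda>n. 2 * exp (- 2 * \<epsilon>\<^sup>2) ^ n)"
      using eps by (intro summable_mult summable_geometric) simp
  qed
  then have "AE w in M. \<forall>\<^sub>F n in sequentially. w \<in> space M - A n"
    by (intro borel_cantelli_AE1) (auto simp: emeasure_eq_measure)
  then show ?thesis
  proof eventually_elim
    case (elim w)
    then show ?case using eventually_gt_at_top[of 0]
    proof eventually_elim
      case (elim n)
      have "ecdf U n w t = (\<Sum>i<n. indicator {..t} (U i w)) / real n"
        by (simp add: ecdf_def indicator_def sum_of_bool_eq Int_def)
      then have "(\<Sum>i<n. indicator {..t} (U i w)) - real n * t = real n * (ecdf U n w t - t)"
        using elim by (simp add: field_simps)
      then have "real n * \<bar>ecdf U n w t - t\<bar> < real n * \<epsilon>"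
        using elim by (auto simp: A_def abs_mult)
      then show ?case using elim by simp
    qed
  qed
qed

lemma (in iid_uniform) glivenko_cantelli:
  "AE w in M. \<forall>\<eta>>0. \<forall>\<^sub>F n in sequentially. \<forall>t\<in>{0..1}. \<bar>ecdf U n w t - t\<bar> \<le> \<eta>"
proof -
  \<comment> \<open>Only countably many grid points and tolerances occur, which yields one null set
    serving every \<eta>.\<close>
  have "AE w in M. \<forall>m j p. j \<le> Suc m \<longrightarrow>
     (\<forall>\<^sub>F n in sequentially. \<bar>ecdf U n w (real j / real (Suc m)) - real j / real (Suc m)\<bar> < 1 / real (Suc p))"
    unfolding AE_all_countable
  proof (intro allI)
    fix m j p
    show "AE w in M. j \<le> Suc m \<longrightarrow>
     (\<forall>\<^sub>F n in sequentially. \<bar>ecdf U n w (real j / real (Suc m)) - real j / real (Suc m)\<bar> < 1 / real (Suc p))"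
      using ecdf_tendsto_pointwise[of "real j / real (Suc m)" "1 / real (Suc p)"]
      by (cases "j \<le> Suc m") auto
  qed
  then show ?thesis
  proof eventually_elim
    case (elim w)
    show ?case
    proof (intro allI impI)
      fix \<eta> :: real assume "0 < \<eta>"
      \<comment> \<open>The value 1 / (m + 1) serves both as mesh and as tolerance at the grid
        points; monotone interpolation adds the two, hence \<eta> / 2.\<close>
      then obtain m where m: "1 / real (Suc m) < \<eta> / 2"
        using nat_approx_posE[of "\<eta> / 2"] by (auto simp: field_simps)
      let ?q = "\<lambda>j. real j / real (Suc m)"
      have "\<forall>\<^sub>F n in sequentially. \<forall>j\<in>{..Suc m}. \<bar>ecdf U n w (?q j) - ?q j\<bar> < 1 / real (Suc m)"
        using elim by (intro eventually_ball_finite) auto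
      then show "\<forall>\<^sub>F n in sequentially. \<forall>t\<in>{0..1}. \<bar>ecdf U n w t - t\<bar> \<le> \<eta>"
      proof eventually_elim
        case (elim n)
        show ?case
        proof
          fix t :: real assume t: "t \<in> {0..1}"
          obtain j where j: "j \<le> m" "?q j \<le> t" "t \<le> ?q (Suc j)"
          \<comment> \<open>At t = 1 the floor would be \<open>Suc m\<close>, one past the last
            cell.\<close>
          proof (cases "t = 1")
            case True
            then show ?thesis by (intro that[of m]) auto
          next
            case False
            define j where "j = nat \<lfloor>t * real (Suc m)\<rfloor>"
            have fl: "real j \<le> t * real (Suc m)" "t * real (Suc m) < real j + 1"
              using t unfolding j_def by (auto simp del: of_nat_Suc)
            have "t * real (Suc m) < real (Suc m)" using False t by (simp del: of_nat_Suc)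
            with fl(1) have "j < Suc m" by linarith
            then show ?thesis using fl by (intro that[of j]) (auto simp: field_simps)
          qed
          have "ecdf U n w (?q j) \<le> ecdf U n w t" "ecdf U n w t \<le> ecdf U n w (?q (Suc j))"
            using j by (auto intro: ecdf_mono)
          moreover have "\<bar>ecdf U n w (?q j) - ?q j\<bar> < 1 / real (Suc m)"
            "\<bar>ecdf U n w (?q (Suc j)) - ?q (Suc j)\<bar> < 1 / real (Suc m)"
            using bspec[OF elim, of j] bspec[OF elim, of "Suc j"] j by auto
          moreover have "?q (Suc j) = ?q j + 1 / real (Suc m)" by (simp add: field_simps)
          ultimately show "\<bar>ecdf U n w t - t\<bar> \<le> \<eta>" using j m by linarith
        qed
      qed
    qed
  qed
qed

text \<open>A zero at t < 1 would propagate by monotonicity to the whole interval [t, 1], of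
  positive length, and make the integral of 1 / h infinite. The value at 1 itself may be 0.\<close>

lemma Hdec_pos:
  assumes "Hdec h" "t \<in> {0..<1}"
  shows "0 < h t"
proof (rule ccontr)
  assume "\<not> 0 < h t"
  then have "h s = 0" if "s \<in> {t..1}" for s
  proof -
    have "0 \<le> h s" "h s \<le> h t" using assms that by (auto simp: Hdec_def)
    with \<open>\<not> 0 < h t\<close> show ?thesis by simp
  qed
  then have "(\<integral>\<^sup>+ s. \<infinity> * indicator {t..1} s \<partial>lborel) \<le> (\<integral>\<^sup>+ s. indicator {0..1} s * inverse (ennreal (h s)) \<partial>lborel)"
    using assms by (intro nn_integral_mono) (auto simp: indicator_def)
  also have "\<dots> < \<infinity>" using assms by (simp add: Hdec_def)
  also have "(\<integral>\<^sup>+ s. \<infinity> * indicator {t..1} s \<partial>lborel) = \<infinity> * emeasure lborel {t..1}"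
    by (rule nn_integral_cmult_indicator) simp
  finally show False using assms by (simp add: ennreal_top_mult)
qed

lemma Hdec_antimono: "Hdec h \<Longrightarrow> 0 \<le> s \<Longrightarrow> s \<le> t \<Longrightarrow> t \<le> 1 \<Longrightarrow> h t \<le> h s"
  by (auto simp: Hdec_def)

lemma antimono_borel_measurable:
  fixes f :: "real \<Rightarrow> real"
  assumes "antimono f"
  shows "f \<in> borel_measurable borel"
proof -
  have "mono (\<lambda>x. - f x)" using assms by (auto simp: mono_def antimono_def)
  from borel_measurable_mono[OF this] show ?thesis by simp
qed

text \<open>\<open>Hdec h\<close> says nothing about \<open>h\<close> outside the unit interval, so measurability needs the clamp.\<close>

lemma Hdec_clamp_measurable:
  assumes "Hdec h"
  shows "(\<lambda>t. h (max 0 (min 1 t))) \<in> borel_measurable borel"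
  using assms by (intro antimono_borel_measurable) (auto simp: antimono_def Hdec_def)

text \<open>On the half-open interval \<open>h\<close> is positive, so the real inverse agrees with
  the extended one; at 1 they could differ, being 0 and infinity when h vanishes there.\<close>

lemma Hdec_integrable_inverse:
  assumes h: "Hdec h"
  shows "integrable lborel (\<lambda>t. indicator {0..<1} t * inverse (h (max 0 (min 1 t))))"
proof (rule integrableI_nonneg)
  note [measurable] = Hdec_clamp_measurable[OF h]
  show "(\<lambda>t. indicator {0..<1} t * inverse (h (max 0 (min 1 t)))) \<in> borel_measurable lborel"
    by measurable
  show "AE t in lborel. 0 \<le> indicator {0..<1} t * inverse (h (max 0 (min 1 t)))"
    using h by (auto simp: Hdec_def)
  have "(\<integral>\<^sup>+ t. ennreal (indicator {0..<1} t * inverse (h (max 0 (min 1 t)))) \<partial>lborel)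
     \<le> (\<integral>\<^sup>+ s. indicator {0..1} s * inverse (ennreal (h s)) \<partial>lborel)"
    using Hdec_pos[OF h] by (intro nn_integral_mono) (auto simp: indicator_def inverse_ennreal)
  also have "\<dots> < \<infinity>" using h by (simp add: Hdec_def)
  finally show "(\<integral>\<^sup>+ t. ennreal (indicator {0..<1} t * inverse (h (max 0 (min 1 t)))) \<partial>lborel) < \<infinity>" .
qed

text \<open>Dominated convergence as \<theta> increases to 1, with 1 / h itself as the dominating
  function.\<close>

lemma Hdec_small_tail:
  assumes h: "Hdec h" and eps: "0 < \<epsilon>"
  shows "\<exists>\<theta>\<in>{0..<1}. (\<integral>t. indicator {\<theta>..<1} t * inverse (h (max 0 (min 1 t))) \<partial>lborel) < \<epsilon>"
proof -
  note [measurable] = Hdec_clamp_measurable[OF h]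
  let ?r = "\<lambda>t. inverse (h (max 0 (min 1 t)))"
  let ?\<theta> = "\<lambda>m. 1 - 1 / real (Suc m)"
  have "(\<lambda>m. \<integral>t. indicator {?\<theta> m..<1} t * ?r t \<partial>lborel) \<longlonglongrightarrow> (\<integral>t. 0 \<partial>(lborel :: real measure))"
  proof (rule integral_dominated_convergence)
    show "integrable lborel (\<lambda>t. indicator {0..<1} t * ?r t)" by (rule Hdec_integrable_inverse[OF h])
    show "AE t in lborel. norm (indicator {?\<theta> m..<1} t * ?r t) \<le> indicator {0..<1} t * ?r t" for m
    proof (rule AE_I2)
      fix t :: real
      have "0 \<le> ?\<theta> m" by simp
      from order_trans[OF this, of t]
      have "indicator {?\<theta> m..<1} t \<le> (indicator {0..<1} t :: real)"
        unfolding indicator_def by (simp del: of_nat_Suc)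
      moreover have "0 \<le> ?r t" using h by (simp add: Hdec_def)
      ultimately show "norm (indicator {?\<theta> m..<1} t * ?r t) \<le> indicator {0..<1} t * ?r t"
        by (simp add: mult_right_mono abs_mult del: of_nat_Suc)
    qed
    show "AE t in lborel. (\<lambda>m. indicator {?\<theta> m..<1} t * ?r t) \<longlonglongrightarrow> 0"
    proof (rule AE_I2)
      fix t :: real
      have "\<forall>\<^sub>F m in sequentially. indicator {?\<theta> m..<1} t * ?r t = 0"
      proof (cases "t < 1")
        case True
        have "(\<lambda>m. 1 - 1 / real (Suc m)) \<longlonglongrightarrow> 1" by real_asymp
        from order_tendstoD(1)[OF this True] show ?thesis
          by eventually_elim (auto simp: indicator_def)
      qed (auto simp: indicator_def)
      then show "(\<lambda>m. indicator {?\<theta> m..<1} t * ?r t) \<longlonglongrightarrow> 0" by (rule tendsto_eventually)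
    qed
  qed auto
  then have "\<forall>\<^sub>F m in sequentially. (\<integral>t. indicator {?\<theta> m..<1} t * ?r t \<partial>lborel) < \<epsilon>"
    using eps by (intro order_tendstoD(2)) auto
  then obtain m where "(\<integral>t. indicator {?\<theta> m..<1} t * ?r t \<partial>lborel) < \<epsilon>"
    by (auto simp: eventually_sequentially)
  then show ?thesis by (intro bexI[of _ "?\<theta> m"]) auto
qed

context iid_uniform begin

lemma U_distributed: "distributed M lborel (U i) (\<lambda>x. ennreal (indicator {0..1} x))"
  using uniform_distributed_iff[of "U i" 0 1] uniform by simp

lemma AE_U_less_1: "AE w in M. U i w < 1"
proof -
  have "prob {w \<in> space M. 1 \<le> U i w} \<le> v" if v: "0 < v" "v \<le> 1" for v
  proof -
    have "prob {w \<in> space M. 1 \<le> U i w} \<le> prob {w \<in> space M. 1 - v < U i w}"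
      using v by (intro finite_measure_mono) auto
    then show ?thesis using prob_U_greater[of v i] v by simp
  qed
  \<comment> \<open>A positive probability p could be used as v = p / 2, giving p \<le> p /
    2.\<close>
  from this[of "prob {w \<in> space M. 1 \<le> U i w} / 2"]
  have "prob {w \<in> space M. 1 \<le> U i w} = 0"
    using prob_le_1[of "{w \<in> space M. 1 \<le> U i w}"]
      measure_nonneg[of M "{w \<in> space M. 1 \<le> U i w}"] by linarith
  then have "AE w in M. w \<notin> {w \<in> space M. 1 \<le> U i w}"
    by (subst prob_eq_0[symmetric]) auto
  with AE_space show ?thesis by eventually_elim auto
qed

text \<open>Since \<open>h\<close> is nonincreasing, \<open>U i w > t\<close> implies \<open>1 / h t \<le> 1 / h (U i w)\<close>, so near \<open>t = 1\<close> the
  weighted empirical tail is dominated, uniformly in \<open>t\<close>, by an average of iid integrable variables.\<close>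

lemma weighted_glivenko_cantelli_eps:
  assumes h: "Hdec h" and eta: "0 < \<eta>"
  shows "AE w in M. \<forall>\<^sub>F n in sequentially. \<forall>t\<in>{0..<1}. \<bar>ecdf U n w t - t\<bar> \<le> \<eta> * h t"
proof -
  let ?r = "\<lambda>t. inverse (h (max 0 (min 1 t)))"
  note [measurable] = Hdec_clamp_measurable[OF h]
  \<comment> \<open>The quarter is calibrated to \<open>iid_sum_le\<close>: mean below \<eta> / 4
    plus slack \<eta> / 4, times the factor 2, gives \<eta>.\<close>
  obtain \<theta> where th: "\<theta> \<in> {0..<1}" and small: "(\<integral>t. indicator {\<theta>..<1} t * ?r t \<partial>lborel) < \<eta> / 4"
    using Hdec_small_tail[OF h, of "\<eta> / 4"] eta by auto
  define g where "g t = indicator {\<theta>..<1} t * ?r t" for t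
  have gm[measurable]: "g \<in> borel_measurable borel" unfolding g_def[abs_def] by measurable
  have g0: "0 \<le> g t" for t using h by (auto simp: g_def Hdec_def indicator_def)
  have gint: "integrable lborel g"
  proof (rule Bochner_Integration.integrable_bound[OF Hdec_integrable_inverse[OF h]])
    show "AE x in lborel. norm (g x) \<le> norm (indicator {0..<1} x * ?r x)"
      using th by (auto simp: g_def indicator_def)
  qed auto
  have g_dens: "(\<lambda>x. indicator {0..1} x * g x) = g"
    using th by (auto simp: g_def indicator_def)
  have EY: "expectation (\<lambda>w. g (U i w)) = (\<integral>t. g t \<partial>lborel)" for i
    using distributed_integral[OF U_distributed[of i], of g] by (simp add: g_dens)
  have intY: "integrable M (\<lambda>w. g (U i w))" for i
    using distributed_integrable[OF U_distributed[of i], of g] gint by (simp add: g_dens)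
  have dU: "distr M borel (U i) = density lborel (\<lambda>x. ennreal (indicator {0..1} x))" for i
    using distributed_distr_eq_density[OF U_distributed[of i]] by (simp add: distr_cong[OF refl sets_lborel[symmetric]])
  have dY: "distr M borel (\<lambda>w. g (U i w)) = distr (distr M borel (U i)) borel g" for i
    by (subst distr_distr) (auto simp: comp_def)
  have "AE w in M. \<forall>\<^sub>F n in sequentially.
      (\<Sum>i<n. g (U i w)) \<le> 2 * real n * (expectation (\<lambda>w. g (U 0 w)) + \<eta> / 4)"
  proof (rule iid_sum_le)
    show "indep_vars (\<lambda>_. borel) (\<lambda>i w. g (U i w)) UNIV"
      by (rule indep_vars_compose2[OF indep]) auto
  qed (use g0 intY eta in \<open>auto simp: dY dU\<close>)
  moreover have "AE w in M. \<forall>i. U i w < 1"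
    using AE_U_less_1 by (simp add: AE_all_countable)
  ultimately show ?thesis using glivenko_cantelli
  proof eventually_elim
    case (elim w)
    \<comment> \<open>On [0, \<theta>) the weight is at least \<open>h \<theta>\<close>, so the
      unweighted theorem with tolerance \<open>\<eta> * h \<theta>\<close> suffices there.\<close>
    have hth: "0 < h \<theta>" using Hdec_pos[OF h th] .
    have "\<forall>\<^sub>F n in sequentially. \<forall>t\<in>{0..1}. \<bar>ecdf U n w t - t\<bar> \<le> \<eta> * h \<theta>"
      using elim(3) eta hth by simp
    then show ?case using elim(1) eventually_gt_at_top[of 0]
    proof eventually_elim
      case n: (elim n)
      show ?case
      proof
        fix t :: real assume t: "t \<in> {0..<1}"
        have ht: "0 < h t" using Hdec_pos[OF h t] .
        show "\<bar>ecdf U n w t - t\<bar> \<le> \<eta> * h t"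
        proof (cases "t < \<theta>")
          case True
          have "\<bar>ecdf U n w t - t\<bar> \<le> \<eta> * h \<theta>" using n(1) t by auto
          also have "\<dots> \<le> \<eta> * h t"
            using eta True t th by (intro mult_left_mono Hdec_antimono[OF h]) auto
          finally show ?thesis .
        next
          case False
          \<comment> \<open>Near 1 no cancellation is used: the empirical and the true tail are each
            shown to be at most \<open>\<eta> * h t\<close>.\<close>
          have "real n * (1 - ecdf U n w t) = exceed n (1 - t) w"
            using exceed_eq_ecdf[of n "1 - t" w] n by simp
          also have "\<dots> \<le> (\<Sum>i<n. h t * g (U i w))"
            unfolding exceed_def
          proof (rule sum_mono)
            fix i
            show "indicator {1 - (1 - t)<..} (U i w) \<le> h t * g (U i w)"
            proof (cases "t < U i w")
              case True
              have u: "U i w \<in> {0..<1}" using elim True t by auto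
              have "h (U i w) \<le> h t" using u t True by (intro Hdec_antimono[OF h]) auto
              moreover have "0 < h (U i w)" using Hdec_pos[OF h u] .
              ultimately have "1 \<le> h t * inverse (h (U i w))" by (simp add: field_simps)
              then show ?thesis using u True False by (simp add: g_def indicator_def)
            qed (use g0 ht in simp)
          qed
          also have "\<dots> = h t * (\<Sum>i<n. g (U i w))" by (simp add: sum_distrib_left)
          also have "\<dots> \<le> h t * (2 * real n * (\<eta> / 4 + \<eta> / 4))"
            using n(2) small ht unfolding EY g_def[symmetric]
            by (intro mult_left_mono order_trans[OF n(2)]) (auto simp: EY)
          also have "\<dots> = real n * (\<eta> * h t)" by simp
          finally have up: "1 - ecdf U n w t \<le> \<eta> * h t" using n by simp
          \<comment> \<open>The deterministic counterpart: on [t, 1) the function 1 / h is at least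
            1 / h t.\<close>
          have "(1 - t) * inverse (h t) = (\<integral>s. indicator {t..<1} s * inverse (h t) \<partial>lborel)"
            using t by simp
          also have "\<dots> \<le> (\<integral>s. g s \<partial>lborel)"
          proof (rule integral_mono)
            show "integrable lborel (\<lambda>s. indicator {t..<1} s * inverse (h t))"
              using t by (intro integrable_mult_left integrable_real_indicator) auto
            show "indicator {t..<1} s * inverse (h t) \<le> g s" for s
            proof (cases "s \<in> {t..<1}")
              case True
              then have "s \<in> {0..<1}" using t by auto
              then have "inverse (h t) \<le> inverse (h s)"
                using True t by (intro le_imp_inverse_le Hdec_antimono[OF h] Hdec_pos[OF h]) auto
              then show ?thesis using True False t by (auto simp: g_def indicator_def)
            qed (use g0 in simp)
          qed (rule gint)
          also have "\<dots> < \<eta> / 4" using small by (simp add: g_def[abs_def])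
          finally have "1 - t < \<eta> / 4 * h t" using ht by (simp add: field_simps)
          moreover have "\<eta> / 4 * h t \<le> \<eta> * h t" using eta ht by (intro mult_right_mono) auto
          moreover have "ecdf U n w t \<le> 1" unfolding ecdf_def
          proof -
            have "card {i \<in> {..<n}. U i w \<le> t} \<le> card {..<n}" by (intro card_mono) auto
            then show "real (card {i \<in> {..<n}. U i w \<le> t}) / real n \<le> 1" using n by simp
          qed
          ultimately show ?thesis using up t by (auto simp: abs_le_iff)
        qed
      qed
    qed
  qed
qed

lemma weighted_glivenko_cantelli:
  assumes h: "Hdec h"
  shows "AE w in M. \<forall>\<eta>>0. \<forall>\<^sub>F n in sequentially. \<forall>t\<in>{0..<1}. \<bar>ecdf U n w t - t\<bar> \<le> \<eta> * h t"
proof -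
  have "AE w in M. \<forall>p. \<forall>\<^sub>F n in sequentially. \<forall>t\<in>{0..<1}. \<bar>ecdf U n w t - t\<bar> \<le> 1 / real (Suc p) * h t"
    unfolding AE_all_countable by (intro allI weighted_glivenko_cantelli_eps[OF h]) simp
  then show ?thesis
  proof eventually_elim
    case (elim w)
    show ?case
    proof (intro allI impI)
      fix \<eta> :: real assume "0 < \<eta>"
      then obtain p where p: "1 / real (Suc p) < \<eta>" using nat_approx_posE by metis
      show "\<forall>\<^sub>F n in sequentially. \<forall>t\<in>{0..<1}. \<bar>ecdf U n w t - t\<bar> \<le> \<eta> * h t"
        using spec[OF elim, of p]
      proof eventually_elim
        case (elim n)
        show ?case
        proof
          fix t :: real assume t: "t \<in> {0..<1}"
          have "1 / real (Suc p) * h t \<le> \<eta> * h t"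
            using p Hdec_pos[OF h t] by (intro mult_right_mono) auto
          then show "\<bar>ecdf U n w t - t\<bar> \<le> \<eta> * h t" using elim t by fastforce
        qed
      qed
    qed
  qed
qed

end

section \<open>Empirical mean residual life\<close>

locale iid_lifetimes = prob_space M for M :: "'a measure" +
  fixes X :: "nat \<Rightarrow> 'a \<Rightarrow> real" and F f :: "real \<Rightarrow> real"
  assumes indep: "indep_vars (\<lambda>_. borel) X UNIV"
    and dens: "\<And>i. distributed M lborel (X i) (\<lambda>x. ennreal (f x))"
    and F_def: "\<And>x. F x = measure M {w \<in> space M. X 0 w \<le> x}"
    and F_cont: "continuous_on UNIV F"
    and F_supp: "\<And>x. x < 0 \<Longrightarrow> F x = 0"
    and f_pos: "\<And>x. 0 \<le> x \<Longrightarrow> 0 < f x"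
    and mean: "integrable M (X 0)"
begin

section \<open>The distribution function, its quantiles and survival integrals\<close>

lemma X_measurable[measurable]: "X i \<in> borel_measurable M"
  using indep by (auto simp: indep_vars_def)

lemma f_measurable: "(\<lambda>x. ennreal (f x)) \<in> borel_measurable borel"
  using distributed_borel_measurable[OF dens] by simp

lemma emeasure_X: "A \<in> sets borel \<Longrightarrow>
    emeasure M {w \<in> space M. X i w \<in> A} = (\<integral>\<^sup>+x. ennreal (f x) * indicator A x \<partial>lborel)"
  using distributed_emeasure[OF dens, of A i] by (simp add: vimage_def Int_def conj_commute)

lemma prob_X_le: "prob {w \<in> space M. X i w \<le> x} = F x"
  using emeasure_X[of "{..x}" i] emeasure_X[of "{..x}" 0] by (simp add: F_def measure_def)

lemma F_mono: "x \<le> y \<Longrightarrow> F x \<le> F y"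
  unfolding F_def by (intro finite_measure_mono) auto

lemma F_nonneg: "0 \<le> F x"
  by (simp add: F_def)

text \<open>Equality would make the density vanish almost everywhere on an interval of positive
  length. Strictness lets events about \<open>F (X i)\<close> be read back as events about
  \<open>X i\<close>.\<close>

lemma F_strict_mono:
  assumes "0 \<le> x" "x < y"
  shows "F x < F y"
proof (rule ccontr)
  assume "\<not> F x < F y"
  then have "F y = F x" using F_mono[of x y] assms by simp
  have "{w \<in> space M. X 0 w \<le> y} = {w \<in> space M. X 0 w \<le> x} \<union> {w \<in> space M. X 0 w \<in> {x<..y}}"
    using assms by auto
  then have "F y = F x + prob {w \<in> space M. X 0 w \<in> {x<..y}}"
    unfolding F_def by (simp only:) (rule finite_measure_Union, auto)
  then have "emeasure M {w \<in> space M. X 0 w \<in> {x<..y}} = 0"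
    using \<open>F y = F x\<close> by (simp add: emeasure_eq_measure)
  then have "(\<integral>\<^sup>+t. ennreal (f t) * indicator {x<..y} t \<partial>lborel) = 0"
    using emeasure_X[of "{x<..y}" 0] by simp
  then have "AE t in lborel. ennreal (f t) * indicator {x<..y} t = 0"
    using f_measurable by (subst (asm) nn_integral_0_iff_AE) auto
  then have "AE t in lborel. t \<notin> {x<..y}"
  proof eventually_elim
    case (elim t)
    show ?case
    proof
      assume t: "t \<in> {x<..y}"
      then have "0 < f t" using assms by (intro f_pos) auto
      with elim t show False by (auto simp: indicator_def)
    qed
  qed
  then have "emeasure lborel {x<..y} = 0"
    using AE_iff_null_sets[of "{x<..y}" lborel] by auto
  then show False using assms by simp
qed

lemma F_less_1: "F x < 1"
proof -
  have "F x \<le> F (max 0 x)" by (rule F_mono) simp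
  also have "\<dots> < F (max 0 x + 1)" by (rule F_strict_mono) auto
  also have "\<dots> \<le> 1" by (simp add: F_def)
  finally show ?thesis .
qed

lemma F_le_iff: "0 \<le> x \<Longrightarrow> F y \<le> F x \<longleftrightarrow> y \<le> x"
  using F_mono[of y x] F_strict_mono[of x y] by (meson leD leI)

lemma F_measurable[measurable]: "F \<in> borel_measurable borel"
  using F_cont by (rule borel_measurable_continuous_onI)

lemma F_0: "F 0 = 0"
proof (rule ccontr)
  assume "F 0 \<noteq> 0"
  then have "0 < F 0" using F_nonneg[of 0] by simp
  \<comment> \<open>Continuity excludes an atom at 0: half the jump would be attained on [-1, 0],
    where F takes only the values 0 and \<open>F 0\<close>.\<close>
  moreover have "\<exists>z\<ge>-1. z \<le> 0 \<and> F z = F 0 / 2"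
    using F_supp[of "-1"] F_nonneg[of 0] by (intro IVT' continuous_on_subset[OF F_cont]) auto
  ultimately show False using F_supp by (metis div_0 field_sum_of_halves less_add_same_cancel1 less_eq_real_def less_irrefl half_gt_zero_iff)
qed

lemma quantile_ex:
  assumes "0 \<le> u" "u < 1"
  shows "\<exists>x\<ge>0. F x = u"
proof -
  interpret D: prob_space "distr M borel (X 0)" by (rule prob_space_distr) simp
  interpret D: real_distribution "distr M borel (X 0)" by unfold_locales auto
  have "cdf (distr M borel (X 0)) = F"
    by (auto simp: cdf_def F_def measure_distr vimage_def Int_def conj_commute)
  then have "(F \<longlongrightarrow> 1) at_top" using D.cdf_lim_at_top_prob by simp
  then have "\<forall>\<^sub>F x in at_top. u < F x" using assms by (intro order_tendstoD(1)) auto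
  then obtain y where y: "\<And>x. x \<ge> y \<Longrightarrow> u < F x" by (auto simp: eventually_at_top_linorder)
  have "\<exists>x\<ge>0. x \<le> max 0 y \<and> F x = u"
    using y[of "max 0 y"] assms F_0 by (intro IVT' continuous_on_subset[OF F_cont]) auto
  then show ?thesis by auto
qed

text \<open>For u > 0 the set in \<open>qf\<close> is a closed half-line, so its infimum is the
  unique preimage. For u = 0 it would be the whole real line.\<close>

lemma qf_eq:
  assumes "0 < u" "u < 1"
  shows "0 \<le> qf F u" "F (qf F u) = u"
proof -
  obtain x where x: "0 \<le> x" "F x = u" using quantile_ex[of u] assms by auto
  have "u \<le> F y \<longleftrightarrow> x \<le> y" for y
  proof (cases "0 \<le> y")
    case True
    then show ?thesis using F_le_iff[of y x] x by simp
  next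
    case False
    then show ?thesis using F_supp[of y] x assms by auto
  qed
  then have "{y. u \<le> F y} = {x..}" by auto
  then have "qf F u = x" by (simp add: qf_def)
  with x show "0 \<le> qf F u" "F (qf F u) = u" by auto
qed

sublocale U: iid_uniform M "\<lambda>i w. F (X i w)"
proof unfold_locales
  show "indep_vars (\<lambda>_. borel) (\<lambda>i w. F (X i w)) UNIV"
    by (rule indep_vars_compose2[OF indep]) auto
  fix i :: nat and t :: real assume t: "t \<in> {0..1}"
  show "prob {w \<in> space M. F (X i w) \<le> t} = t"
  \<comment> \<open>F never reaches 1, so t = 1 has no preimage.\<close>
  proof (cases "t = 1")
    case True
    then have "{w \<in> space M. F (X i w) \<le> t} = space M" using F_less_1 by (auto intro: less_imp_le)
    then show ?thesis using True by (simp add: prob_space)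
  next
    case False
    then obtain x where x: "0 \<le> x" "F x = t" using quantile_ex[of t] t by auto
    then have "{w \<in> space M. F (X i w) \<le> t} = {w \<in> space M. X i w \<le> x}"
      using F_le_iff[of x] by auto
    then show ?thesis using prob_X_le[of i x] x by simp
  qed
qed

lemma ecdf_F: "0 \<le> x \<Longrightarrow> ecdf (\<lambda>i w. F (X i w)) n w (F x) = ecdf X n w x"
  by (simp add: ecdf_def F_le_iff)

text \<open>The tail formula for the mean, by Fubini. Lebesgue integrability is what makes the gauge
  integral in \<open>mrl\<close> genuine rather than a default 0.\<close>

lemma survival_set_integrable:
  assumes "0 \<le> x"
  shows "set_integrable lborel {x..} (\<lambda>t. 1 - F t)"
proof -
  interpret P: pair_sigma_finite M lborel ..
  have "(\<integral>\<^sup>+t. ennreal (indicator {0..} t * (1 - F t)) \<partial>lborel)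
      = (\<integral>\<^sup>+t. (\<integral>\<^sup>+w. (if 0 \<le> t \<and> t < X 0 w then 1 else 0) \<partial>M) \<partial>lborel)"
  proof (intro nn_integral_cong)
    fix t :: real
    have "(\<integral>\<^sup>+w. (if 0 \<le> t \<and> t < X 0 w then 1 else 0) \<partial>M)
      = (\<integral>\<^sup>+w. indicator {0..} t * indicator {w \<in> space M. t < X 0 w} w \<partial>M)"
      by (intro nn_integral_cong) (auto simp: indicator_def)
    also have "\<dots> = indicator {0..} t * emeasure M {w \<in> space M. t < X 0 w}"
      by (rule nn_integral_cmult_indicator) simp
    also have "{w \<in> space M. t < X 0 w} = space M - {w \<in> space M. X 0 w \<le> t}" by auto
    also have "emeasure M \<dots> = ennreal (1 - F t)"
      by (simp add: emeasure_eq_measure prob_compl F_def)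
    finally show "ennreal (indicator {0..} t * (1 - F t))
        = (\<integral>\<^sup>+w. (if 0 \<le> t \<and> t < X 0 w then 1 else 0) \<partial>M)"
      by (simp add: indicator_def)
  qed
  also have "\<dots> = (\<integral>\<^sup>+w. (\<integral>\<^sup>+t. (if 0 \<le> t \<and> t < X 0 w then 1 else 0) \<partial>lborel) \<partial>M)"
    by (rule P.Fubini') measurable
  \<comment> \<open>The absolute value gives a bound for every w, although \<open>X 0\<close> is
    nonnegative only almost surely.\<close>
  also have "\<dots> \<le> (\<integral>\<^sup>+w. ennreal \<bar>X 0 w\<bar> \<partial>M)"
  proof (intro nn_integral_mono)
    fix w
    have "(\<integral>\<^sup>+t. (if 0 \<le> t \<and> t < X 0 w then 1 else 0) \<partial>lborel)
      \<le> (\<integral>\<^sup>+t. indicator {0..\<bar>X 0 w\<bar>} t \<partial>lborel)"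
      by (intro nn_integral_mono) (auto simp: indicator_def)
    then show "(\<integral>\<^sup>+t. (if 0 \<le> t \<and> t < X 0 w then 1 else 0) \<partial>lborel) \<le> ennreal \<bar>X 0 w\<bar>" by simp
  qed
  also have "\<dots> < \<infinity>" using mean by (simp add: integrable_iff_bounded)
  finally have "integrable lborel (\<lambda>t. indicator {0..} t * (1 - F t))"
    using less_imp_le[OF F_less_1] by (intro integrableI_nonneg) (auto intro!: AE_I2 mult_nonneg_nonneg)
  then have "set_integrable lborel {0..} (\<lambda>t. 1 - F t)" by (simp add: set_integrable_def)
  then show ?thesis by (rule set_integrable_subset) (use assms in auto)
qed

lemma mrl_pos:
  assumes "0 \<le> x"
  shows "0 < mrl F x"
proof -
  have int: "(\<lambda>t. 1 - F t) integrable_on {x..}"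
    using set_borel_integral_eq_integral(1)[OF survival_set_integrable[OF assms]] .
  have "0 < 1 - F (x + 1)" using F_less_1[of "x + 1"] by simp
  also have "\<dots> = integral {x..x+1} (\<lambda>_. 1 - F (x + 1))" by simp
  also have "\<dots> \<le> integral {x..x+1} (\<lambda>t. 1 - F t)"
    by (intro integral_le integrable_continuous_interval continuous_intros continuous_on_subset[OF F_cont])
       (auto intro: F_mono)
  also have "\<dots> \<le> integral {x..} (\<lambda>t. 1 - F t)"
    by (intro integral_subset_le int integrable_continuous_interval continuous_intros continuous_on_subset[OF F_cont])
       (use F_less_1 in \<open>auto intro: less_imp_le\<close>)
  finally show ?thesis using F_less_1[of x] by (simp add: mrl_def)
qed

lemma ecdf_survival_set_integrable:
  assumes "0 < n"
  shows "set_integrable lborel {x..} (\<lambda>t. 1 - ecdf X n w t)"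
proof -
  have "indicator {x..} t * (1 - ecdf X n w t) = (\<Sum>i<n. indicator {x..<X i w} t / real n)" for t
  proof -
    have "real n * (1 - ecdf X n w t) = (\<Sum>i<n. 1 - of_bool (X i w \<le> t))"
      using assms by (simp add: ecdf_def sum_subtractf sum_of_bool_eq Int_def right_diff_distrib)
    also have "\<dots> = (\<Sum>i<n. indicator {..<X i w} t)"
      by (intro sum.cong) (auto simp: indicator_def)
    finally have "1 - ecdf X n w t = (\<Sum>i<n. indicator {..<X i w} t / real n)"
      using assms by (simp add: field_simps flip: sum_divide_distrib)
    then have "indicator {x..} t * (1 - ecdf X n w t)
        = (\<Sum>i<n. indicator {x..} t * (indicator {..<X i w} t / real n))"
      by (simp add: sum_distrib_left)
    also have "\<dots> = (\<Sum>i<n. indicator {x..<X i w} t / real n)"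
      by (intro sum.cong) (auto simp: indicator_def)
    finally show ?thesis .
  qed
  moreover have "emeasure lborel {x..<y} < \<top>" for y :: real by (cases "x \<le> y") auto
  ultimately show ?thesis unfolding set_integrable_def
    by (auto intro!: Bochner_Integration.integrable_sum integrable_divide integrable_real_indicator)
qed

lemma h_F_measurable:
  assumes "Hdec h"
  shows "(\<lambda>t. h (F t)) \<in> borel_measurable borel"
proof -
  have "max 0 (min 1 (F t)) = F t" for t
    using F_nonneg[of t] F_less_1[of t] by simp
  then have "(\<lambda>t. h (F t)) = (\<lambda>t. h (max 0 (min 1 (F t))))" by simp
  also have "\<dots> \<in> borel_measurable borel"
    using measurable_compose[OF F_measurable Hdec_clamp_measurable[OF assms]] by simp
  finally show ?thesis .
qed

lemma h_F_pos: "Hdec h \<Longrightarrow> 0 < h (F x)"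
  using Hdec_pos[of h "F x"] F_nonneg F_less_1 by simp

text \<open>A statement about one sample point: all randomness enters through \<open>dev\<close> and
  \<open>ratio\<close>. The number K stands for whatever bound on the tail integral of h(F) is at
  hand.\<close>

lemma emrl_error_bound:
  assumes h: "Hdec h" and x: "0 \<le> x" and n: "0 < n" and c: "0 < c" and \<eta>: "0 < \<eta>" and K: "0 \<le> K"
    and hK: "(\<integral>\<^sup>+ t. indicator {x..} t * ennreal (h (F t)) \<partial>lborel) \<le> ennreal K"
    and dev: "\<And>t. 0 \<le> t \<Longrightarrow> \<bar>ecdf X n w t - F t\<bar> \<le> \<eta> * h (F t)"
    and ratio: "c * (1 - F x) \<le> 1 - ecdf X n w x"
  shows "\<bar>emrl X n w x - mrl F x\<bar> * (1 - F x) \<le> \<eta> / c * (K + h (F x) * mrl F x)"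
proof -
  let ?S = "1 - F x" and ?Sn = "1 - ecdf X n w x"
  have S: "0 < ?S" using F_less_1[of x] by simp
  then have Sn: "0 < ?Sn" using ratio c by (meson less_le_trans mult_pos_pos)
  have "\<exists>i<n. x < X i w"
  proof (rule ccontr)
    assume "\<not> (\<exists>i<n. x < X i w)"
    then have "X i w \<le> x" if "i < n" for i using that by (meson not_le)
    then have "{i \<in> {..<n}. X i w \<le> x} = {..<n}" by auto
    then show False using Sn n by (simp add: ecdf_def)
  qed
  then have "x < smax X n w" using n by (auto simp: smax_def Max_gr_iff lessThan_empty_iff)
  note hm[measurable] = h_F_measurable[OF h]
  \<comment> \<open>The finite bound \<open>hK\<close> supplies integrability of h(F), which is
    needed before passing to the gauge integral.\<close>
  have hint: "set_integrable lborel {x..} (\<lambda>t. h (F t))"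
    unfolding set_integrable_def
  proof (rule integrableI_nonneg)
    show "AE t in lborel. 0 \<le> indicator {x..} t *\<^sub>R h (F t)"
      using less_imp_le[OF h_F_pos[OF h]] by (auto intro!: AE_I2 mult_nonneg_nonneg)
    have "(\<integral>\<^sup>+ t. ennreal (indicator {x..} t *\<^sub>R h (F t)) \<partial>lborel)
       = (\<integral>\<^sup>+ t. indicator {x..} t * ennreal (h (F t)) \<partial>lborel)"
      by (intro nn_integral_cong) (auto simp: indicator_def)
    also have "\<dots> < \<infinity>" using hK by (rule le_less_trans) simp
    finally show "(\<integral>\<^sup>+ t. ennreal (indicator {x..} t *\<^sub>R h (F t)) \<partial>lborel) < \<infinity>" .
  qed auto
  have "ennreal (integral {x..} (\<lambda>t. h (F t))) = ennreal (LINT t:{x..}|lborel. h (F t))"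
    using set_borel_integral_eq_integral(2)[OF hint] by simp
  also have "\<dots> = (\<integral>\<^sup>+ t. ennreal (indicator {x..} t *\<^sub>R h (F t)) \<partial>lborel)"
    unfolding set_lebesgue_integral_def using hint less_imp_le[OF h_F_pos[OF h]]
    by (intro nn_integral_eq_integral[symmetric])
       (auto simp: set_integrable_def intro!: AE_I2 mult_nonneg_nonneg)
  also have "\<dots> = (\<integral>\<^sup>+ t. indicator {x..} t * ennreal (h (F t)) \<partial>lborel)"
    by (intro nn_integral_cong) (auto simp: indicator_def)
  also note hK
  finally have hI: "integral {x..} (\<lambda>t. h (F t)) \<le> K"
    by (rule ennreal_le_iff[OF K, THEN iffD1])
  note io = set_borel_integral_eq_integral(1)
  have iF: "(\<lambda>t. 1 - F t) integrable_on {x..}"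
    by (rule io[OF survival_set_integrable[OF x]])
  have iE: "(\<lambda>t. 1 - ecdf X n w t) integrable_on {x..}"
    by (rule io[OF ecdf_survival_set_integrable[OF n]])
  have ih: "(\<lambda>t. \<eta> * h (F t)) integrable_on {x..}"
    using integrable_cmul[OF io[OF hint], of \<eta>] by simp
  define In where "In = integral {x..} (\<lambda>t. 1 - ecdf X n w t)"
  define I where "I = integral {x..} (\<lambda>t. 1 - F t)"
  have "In - I = integral {x..} (\<lambda>t. (1 - ecdf X n w t) - (1 - F t))"
    unfolding In_def I_def by (rule Henstock_Kurzweil_Integration.integral_diff[OF iE iF, symmetric])
  also have "norm \<dots> \<le> integral {x..} (\<lambda>t. \<eta> * h (F t))"
    using dev x by (intro integral_norm_bound_integral integrable_diff iE iF ih)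
       (auto simp: abs_minus_commute)
  also have "\<dots> \<le> \<eta> * K" using hI \<eta> by simp
  finally have InI: "\<bar>In - I\<bar> \<le> \<eta> * K" by simp
  have mp: "0 < mrl F x" by (rule mrl_pos[OF x])
  have I: "I = ?S * mrl F x" using S by (simp add: I_def mrl_def)
  have "emrl X n w x = In / ?Sn" using x \<open>x < smax X n w\<close> by (simp add: emrl_def In_def)
  then have "In = ?Sn * emrl X n w x" using Sn by simp
  then have "(In - I) - (F x - ecdf X n w x) * mrl F x = ?Sn * (emrl X n w x - mrl F x)"
    unfolding I by (simp add: algebra_simps)
  then have "(emrl X n w x - mrl F x) * ?S = ?S / ?Sn * ((In - I) - (F x - ecdf X n w x) * mrl F x)"
    using Sn by simp
  then have "\<bar>emrl X n w x - mrl F x\<bar> * ?S = ?S / ?Sn * \<bar>(In - I) - (F x - ecdf X n w x) * mrl F x\<bar>"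
    using S Sn by (metis abs_mult abs_of_pos divide_pos_pos)
  also have "\<dots> \<le> 1 / c * (\<eta> * K + \<eta> * h (F x) * mrl F x)"
  proof (intro mult_mono)
    show "?S / ?Sn \<le> 1 / c" using ratio c Sn by (simp add: field_simps)
    have "\<bar>(F x - ecdf X n w x) * mrl F x\<bar> \<le> \<eta> * h (F x) * mrl F x"
      using dev[OF x] mp by (simp add: abs_mult abs_minus_commute)
    with InI show "\<bar>(In - I) - (F x - ecdf X n w x) * mrl F x\<bar> \<le> \<eta> * K + \<eta> * h (F x) * mrl F x"
      by linarith
  qed (use c in auto)
  also have "\<dots> = \<eta> / c * (K + h (F x) * mrl F x)" by (simp add: algebra_simps)
  finally show ?thesis .
qed

end

text \<open>Nonemptiness matters because the supremum of the empty set in \<open>ereal\<close> is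
  minus infinity.\<close>

lemma SUP_ereal_tendsto_0:
  assumes ne: "\<forall>\<^sub>F n in F. A n \<noteq> {}"
    and le: "\<And>\<epsilon>. 0 < \<epsilon> \<Longrightarrow> \<forall>\<^sub>F n in F. \<forall>x\<in>A n. 0 \<le> g n x \<and> g n x \<le> (\<epsilon>::real)"
  shows "((\<lambda>n. SUP x\<in>A n. ereal (g n x)) \<longlongrightarrow> 0) F"
proof (rule order_tendstoI)
  fix a :: ereal assume "a < 0"
  show "\<forall>\<^sub>F n in F. a < (SUP x\<in>A n. ereal (g n x))"
    using ne le[OF zero_less_one]
  proof eventually_elim
    case (elim n)
    then obtain x where "x \<in> A n" by auto
    with elim have "0 \<le> ereal (g n x)" "x \<in> A n" by auto
    then have "0 \<le> (SUP x\<in>A n. ereal (g n x))" by (meson SUP_upper order_trans)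
    with \<open>a < 0\<close> show ?case by (rule less_le_trans)
  qed
next
  fix a :: ereal assume "0 < a"
  then obtain e where e: "0 < ereal e" "ereal e < a" using ereal_dense2 by blast
  then have "0 < e" by simp
  show "\<forall>\<^sub>F n in F. (SUP x\<in>A n. ereal (g n x)) < a"
    using le[OF \<open>0 < e\<close>]
  proof eventually_elim
    case (elim n)
    then have "(SUP x\<in>A n. ereal (g n x)) \<le> ereal e" by (intro SUP_least) auto
    with e show ?case by simp
  qed
qed

section \<open>Uniform consistency up to the cutoff\<close>

context iid_lifetimes begin

text \<open>The common core of both parts: d is the normaliser, \<open>h(F) * mrl\<close> in (i) and
  1 in (ii), and B compares the pathwise error bound with it.\<close>

lemma emrl_uniform_consistency:
  fixes K d :: "real \<Rightarrow> real"
  assumes alpha: "1 < \<alpha>" and h: "Hdec h"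
    and K: "\<And>x. 0 \<le> x \<Longrightarrow> 0 \<le> K x"
    and hK: "\<And>x. 0 \<le> x \<Longrightarrow> (\<integral>\<^sup>+ t. indicator {x..} t * ennreal (h (F t)) \<partial>lborel) \<le> ennreal (K x)"
    and d: "\<And>x. 0 \<le> x \<Longrightarrow> 0 < d x"
    and B: "\<And>x. 0 \<le> x \<Longrightarrow> K x + h (F x) * mrl F x \<le> B * d x"
  shows "AE w in M. (\<lambda>n. SUP x\<in>{0..qf F (1 - \<alpha> * ln (ln (real n)) / real n)}.
            ereal (\<bar>emrl X n w x - mrl F x\<bar> * (1 - F x) / d x)) \<longlonglongrightarrow> 0"
proof -
  let ?a = "\<lambda>n. \<alpha> * ln (ln (real n)) / real n"
  obtain c where c: "0 < c" and AEc: "AE w in M. \<forall>\<^sub>F n in sequentially.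
      \<forall>v\<in>{?a n..1}. c * (real n * v) \<le> U.exceed n v w"
    using U.exceed_ge[OF alpha] by blast
  have "0 < B"
  proof -
    have "0 < h (F 0) * mrl F 0" using h_F_pos[OF h] mrl_pos by simp
    then have "0 < B * d 0" using B[of 0] K[of 0] by linarith
    then show ?thesis using d[of 0] by (simp add: zero_less_mult_iff)
  qed
  \<comment> \<open>The level lies in (0, 1) only for large n; there \<open>qf\<close> is a true
    quantile.\<close>
  have "\<forall>\<^sub>F n in sequentially. 0 < ?a n" using alpha by real_asymp
  moreover have "\<forall>\<^sub>F n in sequentially. ?a n < 1" using alpha by real_asymp
  ultimately have ev: "\<forall>\<^sub>F n in sequentially. 0 < ?a n \<and> ?a n < 1 \<and> 0 < n"
    using eventually_gt_at_top[of 0] by eventually_elim auto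
  show ?thesis using AEc U.weighted_glivenko_cantelli[OF h]
  proof eventually_elim
    case (elim w)
    show ?case
    proof (rule SUP_ereal_tendsto_0)
      show "\<forall>\<^sub>F n in sequentially. {0..qf F (1 - ?a n)} \<noteq> {}"
        using ev by eventually_elim (use qf_eq(1) in auto)
      fix \<epsilon> :: real assume "0 < \<epsilon>"
      \<comment> \<open>Chosen so that \<open>\<eta> / c * (B * d x)\<close> is exactly
        \<open>\<epsilon> * d x\<close>.\<close>
      define \<eta> where "\<eta> = \<epsilon> * c / B"
      have \<eta>: "0 < \<eta>" using \<open>0 < \<epsilon>\<close> c \<open>0 < B\<close> by (simp add: \<eta>_def)
      have "\<forall>\<^sub>F n in sequentially. \<forall>t\<in>{0..<1}. \<bar>ecdf (\<lambda>i w. F (X i w)) n w t - t\<bar> \<le> \<eta> * h t"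
        using elim(2) \<eta> by simp
      then show "\<forall>\<^sub>F n in sequentially. \<forall>x\<in>{0..qf F (1 - ?a n)}.
        0 \<le> \<bar>emrl X n w x - mrl F x\<bar> * (1 - F x) / d x \<and>
        \<bar>emrl X n w x - mrl F x\<bar> * (1 - F x) / d x \<le> \<epsilon>"
        using elim(1) ev
      proof eventually_elim
        case n: (elim n)
        show ?case
        proof
          fix x assume xb: "x \<in> {0..qf F (1 - ?a n)}"
          then have x: "0 \<le> x" by simp
          have "F x \<le> F (qf F (1 - ?a n))" using xb by (intro F_mono) simp
          also have "\<dots> = 1 - ?a n" using n(3) by (intro qf_eq(2)) auto
          finally have "1 - F x \<in> {?a n..1}" using F_nonneg[of x] by auto
          then have "c * (real n * (1 - F x)) \<le> U.exceed n (1 - F x) w" using n(2) by blast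
          also have "\<dots> = real n * (1 - ecdf X n w x)"
            using U.exceed_eq_ecdf[of n "1 - F x" w] n(3) ecdf_F[OF x] by simp
          finally have ratio: "c * (1 - F x) \<le> 1 - ecdf X n w x" using n(3) by simp
          have dev: "\<bar>ecdf X n w t - F t\<bar> \<le> \<eta> * h (F t)" if "0 \<le> t" for t
            using bspec[OF n(1), of "F t"] F_nonneg[of t] F_less_1[of t] ecdf_F[OF that, of n w] by simp
          have "\<bar>emrl X n w x - mrl F x\<bar> * (1 - F x) \<le> \<eta> / c * (K x + h (F x) * mrl F x)"
            using n(3) by (intro emrl_error_bound[OF h x _ c \<eta> K[OF x] hK[OF x] dev ratio]) auto
          also have "\<dots> \<le> \<eta> / c * (B * d x)"
            using B[OF x] \<eta> c by (intro mult_left_mono) auto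
          also have "\<dots> = \<epsilon> * d x" using c \<open>0 < B\<close> by (simp add: \<eta>_def)
          finally show "0 \<le> \<bar>emrl X n w x - mrl F x\<bar> * (1 - F x) / d x \<and>
            \<bar>emrl X n w x - mrl F x\<bar> * (1 - F x) / d x \<le> \<epsilon>"
            using d[OF x] F_less_1[of x] by (simp add: pos_divide_le_eq)
        qed
      qed
    qed
  qed
qed

end

theorem theorem2p1:
  fixes M :: "'a measure" and X :: "nat \<Rightarrow> 'a \<Rightarrow> real"
    and F f :: "real \<Rightarrow> real" and \<alpha> :: real
  assumes "prob_space M"
    and indep: "prob_space.indep_vars M (\<lambda>_. borel) X UNIV"
    and dens: "\<And>i. distributed M lborel (X i) (\<lambda>x. ennreal (f x))"
    and F_def: "\<And>x. F x = measure M {w \<in> space M. X 0 w \<le> x}"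
    and F_cont: "continuous_on UNIV F"
    and F_supp: "\<And>x. x < 0 \<Longrightarrow> F x = 0"
    and f_pos: "\<And>x. 0 \<le> x \<Longrightarrow> 0 < f x"
    and mean: "integrable M (X 0)"
    and alpha: "\<alpha> > 1"
  defines "a \<equiv> (\<lambda>n::nat. \<alpha> * ln (ln (real n)) / real n)"
  defines "b \<equiv> (\<lambda>n::nat. qf F (1 - a n))"
  shows
    "(\<forall>h. Hdec h \<and>
        (SUP x\<in>{0..}. (\<integral>\<^sup>+ t. indicator {x..} t * ennreal (h (F t)) \<partial>lborel)
                      / ennreal (h (F x) * mrl F x)) < \<infinity>
      \<longrightarrow> (AE w in M. (\<lambda>n. SUP x\<in>{0..b n}.
              ereal (\<bar>emrl X n w x - mrl F x\<bar> * (1 - F x) / (h (F x) * mrl F x)))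
            \<longlonglongrightarrow> 0))
   \<and> (\<forall>h. Hdec h \<and>
        (\<integral>\<^sup>+ t. indicator {0..} t * ennreal (h (F t)) \<partial>lborel) < \<infinity> \<and>
        bdd_above ((\<lambda>x. mrl F x * h (F x)) ` {0..})
      \<longrightarrow> (AE w in M. (\<lambda>n. SUP x\<in>{0..b n}.
              ereal (\<bar>emrl X n w x - mrl F x\<bar> * (1 - F x)))
            \<longlonglongrightarrow> 0))"
proof (intro conjI allI impI; elim conjE)
  interpret prob_space M by fact
  interpret iid_lifetimes M X F f
    by unfold_locales (fact indep dens F_def F_cont F_supp f_pos mean)+
  let ?N = "\<lambda>h x. \<integral>\<^sup>+ t. indicator {x..} t * ennreal (h (F t)) \<partial>lborel"
  fix h assume h: "Hdec h"
  have pos: "0 < h (F x) * mrl F x" if "0 \<le> x" for x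
    using h_F_pos[OF h] mrl_pos[OF that] by simp
  {
    assume fin: "(SUP x\<in>{0..}. ?N h x / ennreal (h (F x) * mrl F x)) < \<infinity>"
    \<comment> \<open>The real value of the supremum; it plays the role of the constant M1 in the
      statement.\<close>
    define S where "S = enn2real (SUP x\<in>{0..}. ?N h x / ennreal (h (F x) * mrl F x))"
    have S: "ennreal S = (SUP x\<in>{0..}. ?N h x / ennreal (h (F x) * mrl F x))"
      using fin by (simp add: S_def)
    have S0: "0 \<le> S" by (simp add: S_def)
    have "?N h x \<le> ennreal (S * (h (F x) * mrl F x))" if x: "0 \<le> x" for x
    proof -
      let ?d = "ennreal (h (F x) * mrl F x)"
      have "y / ennreal d * ennreal d = y" if "0 < d" for y d
        using that by (simp add: ennreal_divide_times)
      from this[OF pos[OF x], symmetric] have "?N h x = ?N h x / ?d * ?d" .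
      also have "?N h x / ?d \<le> ennreal S" unfolding S using x by (intro SUP_upper) simp
      finally show ?thesis using S0 pos[OF x] by (simp add: ennreal_mult mult_right_mono)
    qed
    moreover have "0 \<le> S * (h (F x) * mrl F x)" if "0 \<le> x" for x
      using S0 pos[OF that] by simp
    \<comment> \<open>With \<open>K x = S * d x\<close> the comparison constant is B = S +
      1.\<close>
    moreover have "S * (h (F x) * mrl F x) + h (F x) * mrl F x \<le> (S + 1) * (h (F x) * mrl F x)" for x
      by (simp add: distrib_right)
    ultimately show "AE w in M. (\<lambda>n. SUP x\<in>{0..b n}.
        ereal (\<bar>emrl X n w x - mrl F x\<bar> * (1 - F x) / (h (F x) * mrl F x))) \<longlonglongrightarrow> 0"
      unfolding b_def a_def using pos
      by (intro emrl_uniform_consistency[OF alpha h, where K="\<lambda>x. S * (h (F x) * mrl F x)"])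
  next
    assume fin: "?N h 0 < \<infinity>" and "bdd_above ((\<lambda>x. mrl F x * h (F x)) ` {0..})"
    then obtain C where C: "\<And>x. 0 \<le> x \<Longrightarrow> mrl F x * h (F x) \<le> C"
      by (auto simp: bdd_above_def)
    \<comment> \<open>The whole integral bounds every tail integral, so here K is constant, d = 1,
      and B adds the bound C on \<open>mrl * h(F)\<close>.\<close>
    have N: "?N h x \<le> ennreal (enn2real (?N h 0))" if "0 \<le> x" for x
    proof -
      have "?N h x \<le> ?N h 0" using that by (intro nn_integral_mono) (auto simp: indicator_def)
      then show ?thesis using fin by simp
    qed
    have "AE w in M. (\<lambda>n. SUP x\<in>{0..b n}.
        ereal (\<bar>emrl X n w x - mrl F x\<bar> * (1 - F x) / 1)) \<longlonglongrightarrow> 0"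
      unfolding b_def a_def using N C
      by (intro emrl_uniform_consistency[OF alpha h, where K="\<lambda>_. enn2real (?N h 0)"
             and B="enn2real (?N h 0) + C"]) (auto simp: mult.commute)
    then show "AE w in M. (\<lambda>n. SUP x\<in>{0..b n}.
        ereal (\<bar>emrl X n w x - mrl F x\<bar> * (1 - F x))) \<longlonglongrightarrow> 0" by simp
  }
qed

end
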